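(* Let $\tau\in\mathfrak M_{1,c}(\mathrm{NHM}(\mathbb{CP}^n))$, where $\mathbb{CP}^n$ is the $n$-dimensional complex projective space. Suppose that $J_{\ker}(G_\tau)=\emptyset$. Then $F_{meas}(\tau)=\mathfrak M_1(\mathbb{CP}^n)$, and for $\tilde\tau$-a.e. $\gamma\in(\mathrm{NHM}(\mathbb{CP}^n))^{\mathbb N}$, $\mathrm{Leb}_{2n}(J_\gamma)=0$.
   Context: Let $Y=\mathbb{CP}^n$ with a metric $d$ inducing its topology. $\mathrm{NHM}(Y)$ is the set of non-constant holomorphic maps $Y\to Y$ with the compact-open topology. $\mathrm{Leb}_{2n}$ is the $2n$-dimensional Lebesgue measure on the $2n$-dimensional smooth manifold $Y$. For a semigroup $G$ (under composition) of continuous self-maps of $Y$: $F(G)$ is the set of $z\in Y$ having a neighborhood $U$ such that $\{g|_U:U\to Y\}_{g\in G}$ is equicontinuous on $U$; $J(G)=Y\setminus F(G)$; $J_{\ker}(G)=\bigcap_{g\in G}g^{-1}(J(G))$. For a sequence $\gamma=(\gamma_1,\gamma_2,\dots)$ of continuous self-maps of $Y$, $J_\gamma$ is the complement of the set of points having a neighborhood on which $\{\gamma_k\circ\cdots\circ\gamma_1\}_{k\in\mathbb N}$ is equicontinuous. For a topological space $X$, $\mathfrak M_1(X)$ is the space of Borel probability measures on $X$ with the topology of weak convergence, $\mathfrak M_{1,c}(X)$ the set of those with compact topological support. For $\tau\in\mathfrak M_{1,c}(\mathrm{NHM}(Y))$: $G_\tau$ is the semigroup generated under composition by $\operatorname{supp}\tau$;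 $\tilde\tau=\otimes_{j=1}^\infty\tau$; $M_\tau:C(Y)\to C(Y)$ is $M_\tau(\varphi)(z)=\int\varphi(g(z))\,d\tau(g)$; $M_\tau^*:\mathfrak M_1(Y)\to\mathfrak M_1(Y)$ is its dual, $\int\varphi\,d(M_\tau^*\mu)=\int M_\tau(\varphi)\,d\mu$. $F_{meas}(\tau)$ is the set of $\mu\in\mathfrak M_1(Y)$ having a neighborhood $B$ in $\mathfrak M_1(Y)$ such that $\{(M_\tau^* )^k|_B:B\to\mathfrak M_1(Y)\}_{k\in\mathbb N}$ is equicontinuous on $B$ (with respect to a metric inducing the topology of the compact metrizable space $\mathfrak M_1(Y)$). *)

theory Defs
  imports "HOL-Probability.Probability" "HOL-Combinatorics.Transposition"
begin

definition cproj_rel :: "complex^('n::finite option) \<Rightarrow> complex^('n option) \<Rightarrow> bool"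
  where "cproj_rel v w \<longleftrightarrow> v \<noteq> 0 \<and> w \<noteq> 0 \<and> (\<exists>c. c \<noteq> 0 \<and> w = c *s v)"

lemma part_equivp_cproj_rel: "part_equivp (cproj_rel :: complex^('n::finite option) \<Rightarrow> _)"
proof (rule part_equivpI)
  have "cproj_rel (1 :: complex^('n option)) 1"
    unfolding cproj_rel_def by (auto intro!: exI[of _ 1] simp: vec_eq_iff)
  then show "\<exists>x. cproj_rel x (x :: complex^('n option))" by blast
  show "symp (cproj_rel :: complex^('n option) \<Rightarrow> _)"
  proof (rule sympI)
    fix v w :: "complex^('n option)"
    assume "cproj_rel v w"
    then obtain c where "v \<noteq> 0" "w \<noteq> 0" "c \<noteq> 0" "w = c *s v"
      by (auto simp: cproj_rel_def)
    then show "cproj_rel w v"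
      unfolding cproj_rel_def by (auto intro!: exI[of _ "inverse c"])
  qed
  show "transp (cproj_rel :: complex^('n option) \<Rightarrow> _)"
  proof (rule transpI)
    fix u v w :: "complex^('n option)"
    assume "cproj_rel u v" "cproj_rel v w"
    then obtain b c where "u \<noteq> 0" "w \<noteq> 0" "b \<noteq> 0" "c \<noteq> 0" "v = b *s u" "w = c *s v"
      by (auto simp: cproj_rel_def)
    then show "cproj_rel u w"
      unfolding cproj_rel_def by (auto intro!: exI[of _ "c * b"])
  qed
qed

text \<open>The type \<open>'n cproj\<close> is complex projective space of complex dimension \<open>n = CARD('n) \<ge> 1\<close>;
  the \<open>n + 1\<close> homogeneous coordinates are indexed by \<open>'n option\<close>.\<close>

quotient_type 'n cproj = "complex^('n::finite option)" / partial: "cproj_rel"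
  by (rule part_equivp_cproj_rel)


instantiation cproj :: (finite) topological_space
begin

definition open_cproj :: "'a cproj set \<Rightarrow> bool"
  where "open_cproj U \<longleftrightarrow> open {v. v \<noteq> 0 \<and> abs_cproj v \<in> U}"

instance
proof
  show "open (UNIV :: 'a cproj set)"
  proof -
    have "{v :: complex^('a option). v \<noteq> 0 \<and> abs_cproj v \<in> UNIV} = - {0}"
      by auto
    then show ?thesis
      unfolding open_cproj_def by (metis closed_singleton open_Compl)
  qed
next
  fix S T :: "'a cproj set"
  assume "open S" "open T"
  then have "open ({v. v \<noteq> 0 \<and> abs_cproj v \<in> S} \<inter> {v. v \<noteq> 0 \<and> abs_cproj v \<in> T})"
    unfolding open_cproj_def by (rule open_Int)
  moreover have "{v. v \<noteq> 0 \<and> abs_cproj v \<in> S \<inter> T} =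
      {v. v \<noteq> 0 \<and> abs_cproj v \<in> S} \<inter> {v. v \<noteq> 0 \<and> abs_cproj v \<in> T}"
    by auto
  ultimately show "open (S \<inter> T)"
    unfolding open_cproj_def by simp
next
  fix K :: "'a cproj set set"
  assume "\<forall>S\<in>K. open S"
  moreover have "{v. v \<noteq> 0 \<and> abs_cproj v \<in> \<Union>K} =
      (\<Union>S\<in>K. {v. v \<noteq> 0 \<and> abs_cproj v \<in> S})"
    by auto
  ultimately show "open (\<Union>K)"
    unfolding open_cproj_def by auto
qed

end

text \<open>Affine charts: on the set of points whose \<open>i\<close>-th homogeneous coordinate does not vanish,
  \<open>chart i\<close> is \<open>[v] \<mapsto> (v\<^sub>k / v\<^sub>i)\<^bsub>k \<noteq> i\<^esub>\<close>. The permutation exchanging \<open>None\<close> and \<open>i\<close> identifies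
  the index set \<open>{k. k \<noteq> i}\<close> with \<open>'n\<close>.\<close>

lift_definition in_chart :: "'n option \<Rightarrow> 'n::finite cproj \<Rightarrow> bool"
  is "\<lambda>i v. v $ i \<noteq> 0"
  by (auto simp: cproj_rel_def)

lift_definition chart :: "'n option \<Rightarrow> 'n::finite cproj \<Rightarrow> complex^'n"
  is "\<lambda>i v. \<chi> j. v $ Transposition.transpose None i (Some j) / v $ i"
  by (auto simp: cproj_rel_def vec_eq_iff)

definition chart_lift :: "'n option \<Rightarrow> complex^'n \<Rightarrow> complex^('n::finite option)"
  where "chart_lift i w = (\<chi> k. if k = i then 1 else w $ the (Transposition.transpose None i k))"

definition chart_inv :: "'n option \<Rightarrow> complex^'n \<Rightarrow> 'n::finite cproj"
  where "chart_inv i w = abs_cproj (chart_lift i w)"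

lemma transpose_None_neq: "Transposition.transpose None i (Some j) \<noteq> i"
  by (auto simp: Transposition.transpose_def)

lemma chart_lift_nth [simp]: "chart_lift i w $ i = 1"
  by (simp add: chart_lift_def)

lemma chart_lift_nz [simp]: "chart_lift i w \<noteq> 0"
  by (metis chart_lift_nth zero_index zero_neq_one)

lemma cproj_rel_refl [simp]: "cproj_rel v v \<longleftrightarrow> v \<noteq> 0"
  unfolding cproj_rel_def by (auto intro!: exI[of _ 1])

lemma in_chart_abs: "v \<noteq> 0 \<Longrightarrow> in_chart i (abs_cproj v) \<longleftrightarrow> v $ i \<noteq> 0"
  by (simp add: in_chart.abs_eq)

lemma chart_abs:
  "v \<noteq> 0 \<Longrightarrow> chart i (abs_cproj v) = (\<chi> j. v $ Transposition.transpose None i (Some j) / v $ i)"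
  by (simp add: chart.abs_eq)

lemma cproj_cases:
  obtains v where "v \<noteq> 0" "p = abs_cproj v"
  using cproj.abs_induct[of "\<lambda>p. \<exists>v. v \<noteq> 0 \<and> p = abs_cproj v" p] by auto

lemma in_chart_chart_inv [simp]: "in_chart i (chart_inv i w)"
  by (simp add: chart_inv_def in_chart_abs)

lemma chart_chart_inv [simp]: "chart i (chart_inv i w) = w"
proof -
  have "chart i (chart_inv i w) =
      (\<chi> j. chart_lift i w $ Transposition.transpose None i (Some j) / chart_lift i w $ i)"
    by (simp only: chart_inv_def chart_abs chart_lift_nz not_False_eq_True)
  also have "\<dots> = w"
    by (simp add: vec_eq_iff chart_lift_def transpose_None_neq)
  finally show ?thesis .
qed

lemma chart_inv_chart [simp]:
  assumes "in_chart i p"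
  shows "chart_inv i (chart i p) = p"
proof -
  obtain v where v: "v \<noteq> 0" "p = abs_cproj v" by (rule cproj_cases)
  then have vi: "v $ i \<noteq> 0" using assms by (simp add: in_chart_abs)
  have "v $ k = v $ i * chart_lift i (chart i p) $ k" for k
  proof (cases "k = i")
    case False
    then obtain j where "Transposition.transpose None i k = Some j"
      by (metis not_None_eq Transposition.transpose_apply_first Transposition.transpose_eq_iff)
    moreover from this have "Transposition.transpose None i (Some j) = k"
      by (metis Transposition.transpose_involutory)
    ultimately show ?thesis
      using False vi v by (simp add: chart_lift_def chart_abs)
  qed simp
  then have "v = v $ i *s chart_lift i (chart i p)"
    unfolding vec_eq_iff vector_smult_component by blast
  then have "cproj_rel (chart_lift i (chart i p)) v"
    using vi v(1) chart_lift_nz unfolding cproj_rel_def by blast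
  then have "abs_cproj (chart_lift i (chart i p)) = abs_cproj v"
    by (rule Quotient3_rel_abs[OF Quotient3_cproj])
  then show ?thesis
    by (simp only: chart_inv_def v(2))
qed

lemma in_some_chart: "\<exists>i. in_chart i p"
proof -
  obtain v where v: "v \<noteq> 0" "p = abs_cproj v" by (rule cproj_cases)
  then obtain i where "v $ i \<noteq> 0" by (auto simp: vec_eq_iff)
  then show ?thesis using v by (auto simp: in_chart_abs)
qed

lemma continuous_on_chart_inv: "continuous_on UNIV (chart_inv i :: _ \<Rightarrow> 'n::finite cproj)"
proof -
  have lift: "continuous_on UNIV (chart_lift i :: complex^'n \<Rightarrow> _)"
    unfolding chart_lift_def
  proof (rule continuous_on_vec_lambda)
    show "continuous_on UNIV (\<lambda>w :: complex^'n. if k = i then 1 else w $ the (Transposition.transpose None i k))"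
      for k by (cases "k = i") (auto intro!: continuous_intros)
  qed
  have "open (chart_inv i -` U)" if "open U" for U :: "'n cproj set"
  proof -
    have "chart_inv i -` U = chart_lift i -` {v. v \<noteq> 0 \<and> abs_cproj v \<in> U}"
      by (auto simp: chart_inv_def)
    moreover have "open (chart_lift i -` {v. v \<noteq> 0 \<and> abs_cproj v \<in> U})"
      using that by (intro open_vimage lift) (simp add: open_cproj_def)
    ultimately show ?thesis by simp
  qed
  then show ?thesis
    unfolding continuous_on_open_vimage[OF open_UNIV] Int_UNIV_right by blast
qed

lemma measurable_chart_inv [measurable]: "chart_inv i \<in> borel_measurable borel"
  by (rule borel_measurable_continuous_onI[OF continuous_on_chart_inv])

text \<open>The Riemannian volume of the Fubini--Study metric (up to a constant factor), written in the
  affine chart \<open>None\<close>, whose complement is a hyperplane. As for every Lebesgue measure on a smooth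
  manifold, its null sets are those Borel sets whose image in each chart is Lebesgue null; see
  lemma \<open>null_sets_leb_cproj_iff\<close>.\<close>

definition leb_cproj :: "'n::finite cproj measure"
  where "leb_cproj = distr
    (density lborel (\<lambda>w :: complex^'n. ennreal (1 / (1 + (norm w)\<^sup>2) ^ (CARD('n) + 1))))
    borel (chart_inv None)"

lemma chart_image: "chart i ` {p \<in> A. in_chart i p} = chart_inv i -` A"
proof (intro equalityI subsetI)
  show "w \<in> chart_inv i -` A" if "w \<in> chart i ` {p \<in> A. in_chart i p}" for w
    using that by auto
  show "w \<in> chart i ` {p \<in> A. in_chart i p}" if "w \<in> chart_inv i -` A" for w
    using that by (intro image_eqI[where x = "chart_inv i w"]) auto
qed

lemma null_sets_leb_cproj_iff:
  fixes A :: "'n::finite cproj set"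
  shows "A \<in> null_sets leb_cproj \<longleftrightarrow>
    A \<in> sets borel \<and> (\<forall>i. negligible (chart i ` {p \<in> A. in_chart i p}))"
proof (cases "A \<in> sets borel")
  case True
  define f where "f = (\<lambda>w :: complex^'n. ennreal (1 / (1 + (norm w)\<^sup>2) ^ (CARD('n) + 1)))"
  have S: "chart_inv i -` A \<in> sets borel" for i
    using measurable_sets_borel[OF measurable_chart_inv True] by simp
  have f: "f \<in> borel_measurable lborel"
    by (simp add: f_def)
  have pos: "f w \<noteq> 0" for w
  proof -
    have "1 + (norm w)\<^sup>2 > 0" by (simp add: add_pos_nonneg)
    then have "1 / (1 + (norm w)\<^sup>2) ^ (CARD('n) + 1) > 0"
      by (intro divide_pos_pos zero_less_power) auto
    then show ?thesis unfolding f_def by (simp only: ennreal_eq_0_iff not_le)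
  qed
  have "A \<in> null_sets leb_cproj \<longleftrightarrow> chart_inv None -` A \<in> null_sets (density lborel f)"
  proof -
    have leb: "leb_cproj = distr (density lborel f) borel (chart_inv None)"
      by (simp only: leb_cproj_def f_def)
    have "chart_inv None \<in> measurable (density lborel f) borel"
      by simp
    from emeasure_distr[OF this True] show ?thesis
      using True S by (simp add: null_sets_def leb)
  qed
  also have "\<dots> \<longleftrightarrow> (AE w in lborel. w \<notin> chart_inv None -` A)"
    using S pos by (simp only: null_sets_density_iff[OF f]) simp
  also have "\<dots> \<longleftrightarrow> chart_inv None -` A \<in> null_sets lborel"
    using S by (subst AE_iff_null_sets) auto
  also have "\<dots> \<longleftrightarrow> negligible (chart_inv None -` A)"
    using S by (simp add: negligible_iff_null_sets null_sets_completion_iff)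
  finally have *: "A \<in> null_sets leb_cproj \<longleftrightarrow> negligible (chart_inv None -` A)" .
  have "negligible (chart_inv i -` A)" if neg: "negligible (chart_inv None -` A)" for i
  proof (cases i)
    case None
    then show ?thesis using neg by simp
  next
    case (Some k)
    define T :: "complex^'n \<Rightarrow> complex^'n"
      where "T = (\<lambda>w. \<chi> j. (if j = k then 1 else w $ j) / w $ k)"
    define S where "S = {w \<in> chart_inv None -` A. w $ k \<noteq> 0}"
    have "negligible S"
      using neg by (rule negligible_subset) (auto simp: S_def)
    moreover have "T differentiable_on S"
      unfolding differentiable_on_def
    proof
      fix w assume "w \<in> S"
      then have nz: "w $ k \<noteq> 0" by (simp add: S_def)
      have nth: "(\<lambda>w :: complex^'n. w $ j) differentiable (at w within S)" for j
        by (intro bounded_linear_imp_differentiable bounded_linear_vec_nth)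
      have coord: "(\<lambda>w. T w $ j) differentiable (at w within S)" for j
        using nz nth[of j] nth[of k]
        by (cases "j = k") (simp_all add: T_def differentiable_divide)
      show "T differentiable (at w within S)"
        by (subst differentiable_componentwise_within)
           (auto simp: Basis_vec_def inner_axis intro!: differentiable_inner coord)
    qed
    ultimately have "negligible (T ` S)"
      by (intro negligible_differentiable_image_negligible) auto
    moreover have "negligible {w :: complex^'n. axis k 1 \<bullet> w = 0}"
      by (rule negligible_hyperplane) (simp add: axis_eq_0_iff)
    ultimately have "negligible (T ` S \<union> {w. axis k 1 \<bullet> w = 0})"
      by simp
    moreover have "chart_inv i -` A \<subseteq> T ` S \<union> {w. axis k 1 \<bullet> w = 0}"
    proof
      fix w assume w: "w \<in> chart_inv i -` A"
      show "w \<in> T ` S \<union> {w. axis k 1 \<bullet> w = 0}"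
      proof (cases "w $ k = 0")
        case True
        then show ?thesis by (simp add: inner_axis')
      next
        case False
        define v where "v = chart_lift i w"
        have v: "v \<noteq> 0" "v $ i = 1" "v $ None = w $ k"
          "\<And>j. j \<noteq> k \<Longrightarrow> v $ Some j = w $ j"
          by (simp_all add: v_def Some) (simp_all add: chart_lift_def Transposition.transpose_def)
        have p: "chart_inv i w = abs_cproj v" by (simp add: chart_inv_def v_def)
        define u where "u = chart None (abs_cproj v)"
        have u: "u $ j = v $ Some j / w $ k" for j
          using v by (simp add: u_def chart_abs)
        have "chart_inv None u = abs_cproj v"
          using v False by (simp add: u_def in_chart_abs)
        then have "u \<in> S"
          using w p u v False Some by (simp add: S_def)
        moreover have "T u = w"
          using u v False Some by (auto simp: T_def vec_eq_iff)
        ultimately show ?thesis by blast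
      qed
    qed
    ultimately show ?thesis by (rule negligible_subset)
  qed
  with * True show ?thesis by (auto simp: chart_image)
next
  case False
  then show ?thesis by (auto simp: null_sets_def leb_cproj_def)
qed

definition holomorphic_vec_on :: "(complex^'m::finite \<Rightarrow> complex^'n::finite) \<Rightarrow> (complex^'m) set \<Rightarrow> bool"
  where "holomorphic_vec_on f W \<longleftrightarrow>
    (\<forall>w\<in>W. \<exists>D. (f has_derivative D) (at w) \<and> Vector_Spaces.linear (*s) (*s) D)"

definition holomorphic_cproj :: "('n::finite cproj \<Rightarrow> 'n cproj) \<Rightarrow> bool"
  where "holomorphic_cproj f \<longleftrightarrow> continuous_on UNIV f \<and>
    (\<forall>i j. holomorphic_vec_on (chart j \<circ> f \<circ> chart_inv i) {w. in_chart j (f (chart_inv i w))})"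

definition NHM :: "('n::finite cproj \<Rightarrow> 'n cproj) set"
  where "NHM = {f. holomorphic_cproj f \<and> \<not> f constant_on UNIV}"

definition compact_open :: "('a::topological_space \<Rightarrow> 'b::topological_space) topology"
  where "compact_open = topology_generated_by
    {{f. continuous_on UNIV f \<and> f ` K \<subseteq> U} | K U. compact K \<and> open U}"

abbreviation NHM_top :: "('n::finite cproj \<Rightarrow> 'n cproj) topology"
  where "NHM_top \<equiv> subtopology compact_open NHM"

lemma topspace_compact_open: "topspace compact_open = {f. continuous_on UNIV f}"
proof -
  have "{f :: 'a \<Rightarrow> 'b. continuous_on UNIV f} \<in>
      {{f. continuous_on UNIV f \<and> f ` K \<subseteq> U} | K U. compact K \<and> open U}"
    by (rule CollectI, rule exI[of _ "{}"], rule exI[of _ UNIV]) simp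
  then show ?thesis
    unfolding compact_open_def topology_generated_by_topspace by auto
qed

lemma topspace_NHM_top: "topspace NHM_top = NHM"
proof -
  have "NHM \<subseteq> {f :: 'a cproj \<Rightarrow> 'a cproj. continuous_on UNIV f}"
    by (simp add: NHM_def holomorphic_cproj_def subset_iff)
  then show ?thesis
    unfolding topspace_subtopology topspace_compact_open by blast
qed

definition borel_of :: "'a topology \<Rightarrow> 'a measure"
  where "borel_of X = sigma (topspace X) {U. openin X U}"

lemma borel_of_euclidean: "borel_of euclidean = borel"
  by (simp add: borel_of_def borel_def)

definition prob_measures :: "'a topology \<Rightarrow> 'a measure set"
  where "prob_measures X = space (prob_algebra (borel_of X))"

lemma prob_measures_iff:
  "\<mu> \<in> prob_measures X \<longleftrightarrow> sets \<mu> = sets (borel_of X) \<and> prob_space \<mu>"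
  by (simp add: prob_measures_def space_prob_algebra)

text \<open>The coarsest topology for which \<open>\<mu> \<mapsto> \<integral>\<phi> d\<mu>\<close> is continuous for each bounded continuous \<open>\<phi>\<close>.\<close>

definition weak_topology :: "'a topology \<Rightarrow> 'a measure topology"
  where "weak_topology X = topology_generated_by
    {{\<mu> \<in> prob_measures X. integral\<^sup>L \<mu> \<phi> \<in> V} | \<phi> V.
      continuous_map X euclideanreal \<phi> \<and> bounded (\<phi> ` topspace X) \<and> open V}"

lemma topspace_weak_topology: "topspace (weak_topology X) = prob_measures X"
proof -
  have "prob_measures X \<in>
      {{\<mu> \<in> prob_measures X. integral\<^sup>L \<mu> \<phi> \<in> V} | \<phi> V.
        continuous_map X euclideanreal \<phi> \<and> bounded (\<phi> ` topspace X) \<and> open V}"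
    by (rule CollectI, rule exI[of _ "\<lambda>_. 0"], rule exI[of _ UNIV])
       (auto intro: finite_imp_bounded finite_subset[of _ "{0}"])
  then show ?thesis
    unfolding weak_topology_def topology_generated_by_topspace by auto
qed

definition topological_support :: "'a topology \<Rightarrow> 'a measure \<Rightarrow> 'a set"
  where "topological_support X \<mu> =
    {x \<in> topspace X. \<forall>U. openin X U \<and> x \<in> U \<longrightarrow> emeasure \<mu> U > 0}"

definition prob_measures_c :: "'a topology \<Rightarrow> 'a measure set"
  where "prob_measures_c X = {\<mu> \<in> prob_measures X. compactin X (topological_support X \<mu>)}"

definition equicontinuous :: "'a metric \<Rightarrow> 'b metric \<Rightarrow> 'a set \<Rightarrow> ('a \<Rightarrow> 'b) set \<Rightarrow> bool"
  where "equicontinuous m m' U \<F> \<longleftrightarrow>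
    (\<forall>x\<in>U. \<forall>\<epsilon>>0. \<exists>\<delta>>0. \<forall>y\<in>U. mdist m x y < \<delta> \<longrightarrow> (\<forall>f\<in>\<F>. mdist m' (f x) (f y) < \<epsilon>))"

definition fatou :: "'a metric \<Rightarrow> ('a \<Rightarrow> 'a) set \<Rightarrow> 'a set"
  where "fatou m \<F> =
    {z \<in> mspace m. \<exists>U. openin (mtopology_of m) U \<and> z \<in> U \<and> equicontinuous m m U \<F>}"

definition julia :: "'a metric \<Rightarrow> ('a \<Rightarrow> 'a) set \<Rightarrow> 'a set"
  where "julia m \<F> = mspace m - fatou m \<F>"

definition kernel_julia :: "'a metric \<Rightarrow> ('a \<Rightarrow> 'a) set \<Rightarrow> 'a set"
  where "kernel_julia m G = (\<Inter>g\<in>G. g -` julia m G)"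

inductive_set comp_semigroup :: "('a \<Rightarrow> 'a) set \<Rightarrow> ('a \<Rightarrow> 'a) set"
  for \<Gamma> :: "('a \<Rightarrow> 'a) set"
  where
    gen: "g \<in> \<Gamma> \<Longrightarrow> g \<in> comp_semigroup \<Gamma>"
  | comp: "g \<in> comp_semigroup \<Gamma> \<Longrightarrow> h \<in> comp_semigroup \<Gamma> \<Longrightarrow> g \<circ> h \<in> comp_semigroup \<Gamma>"

text \<open>Sequences of maps are indexed from \<open>0\<close>, so that \<open>seq_comp \<gamma> k = \<gamma> k \<circ> \<dots> \<circ> \<gamma> 0\<close>.\<close>

primrec seq_comp :: "(nat \<Rightarrow> 'a \<Rightarrow> 'a) \<Rightarrow> nat \<Rightarrow> 'a \<Rightarrow> 'a"
  where
    "seq_comp \<gamma> 0 = \<gamma> 0"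
  | "seq_comp \<gamma> (Suc k) = \<gamma> (Suc k) \<circ> seq_comp \<gamma> k"

definition julia_seq :: "'a metric \<Rightarrow> (nat \<Rightarrow> 'a \<Rightarrow> 'a) \<Rightarrow> 'a set"
  where "julia_seq m \<gamma> = julia m (range (seq_comp \<gamma>))"

definition semigroup_of :: "('n::finite cproj \<Rightarrow> 'n cproj) measure \<Rightarrow> ('n cproj \<Rightarrow> 'n cproj) set"
  where "semigroup_of \<tau> = comp_semigroup (topological_support NHM_top \<tau>)"

definition transition :: "('a \<Rightarrow> 'a) measure \<Rightarrow> ('a \<Rightarrow> real) \<Rightarrow> 'a \<Rightarrow> real"
  where "transition \<tau> \<phi> z = (\<integral>g. \<phi> (g z) \<partial>\<tau>)"

definition transition_dual ::
    "('a::topological_space \<Rightarrow> 'a) measure \<Rightarrow> 'a measure \<Rightarrow> 'a measure"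
  where "transition_dual \<tau> \<mu> = (THE \<nu>. \<nu> \<in> prob_measures euclidean \<and>
    (\<forall>\<phi>. continuous_on UNIV \<phi> \<longrightarrow> integral\<^sup>L \<nu> \<phi> = integral\<^sup>L \<mu> (transition \<tau> \<phi>)))"

text \<open>The argument \<open>\<rho>\<close> is a metric inducing the weak topology on the space of Borel probability
  measures.\<close>

definition F_meas ::
    "'a measure metric \<Rightarrow> ('a::topological_space \<Rightarrow> 'a) measure \<Rightarrow> 'a measure set"
  where "F_meas \<rho> \<tau> = fatou \<rho> ((\<lambda>k. transition_dual \<tau> ^^ k) ` {1..})"

end

theory Submission
  imports Defs
begin

text \<open>Let \<open>A\<close> be the Julia set of the semigroup and \<open>u z\<close> the probability that the random orbit of \<open>z\<close>
  stays in \<open>A\<close> forever. The function \<open>u\<close> is upper semicontinuous, so it attains its maximum on the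
  compact space, and \<open>u z\<close> is the average of \<open>1\<^sub>A u\<close> over the random image of \<open>z\<close>. If the
  maximum were positive, then every element of the semigroup would map a maximum point into \<open>A\<close>,
  against the emptiness of the kernel Julia set. Hence almost every orbit of every point enters the
  Fatou set of the semigroup, and \<open>z\<close> lies in the Fatou set of almost every path. Fubini's theorem
  then makes the Julia set of almost every path a null set, and dominated convergence makes the
  iterates of the transition operator equicontinuous on each continuous function. Weak sequential
  compactness of the space of probability measures (obtained from Helly's selection theorem
  by a Borel embedding into the real line) carries this equicontinuity over to the dual operator.\<close>

text \<open>Escape from \<open>A\<close> is known for each point separately, off a null set of paths
  that depends on the point. For the operators one point at a time is enough; for the Julia sets of
  paths the order of the quantifiers has to be exchanged. Similarly, the radius of equicontinuity of
  a path depends on the path, so no common radius can be integrated; the averages are compared along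
  sequences converging to the point. Of the metric \<open>\<rho>\<close> only the topology is given,
  so closeness of measures is obtained by contradiction, from a convergent subsequence of offending
  images. Helly's theorem lives on the line, into which projective space admits no continuous
  injection: the code is only Borel, and what the argument uses is that decoding is uniformly
  continuous.\<close>

subsection \<open>Complex projective space as a compact metric space\<close>

text \<open>The Hermitian projection onto the line spanned by \<open>v\<close>, as a matrix.\<close>

definition line_projection :: "complex^('n::finite option) \<Rightarrow> complex^('n option)^('n option)"
  where "line_projection v = (\<chi> i j. v $ i * cnj (v $ j) / (\<Sum>k\<in>UNIV. v $ k * cnj (v $ k)))"

lemma sum_mult_cnj_nonzero:
  fixes v :: "complex^('m::finite)"
  assumes "v \<noteq> 0"
  shows "(\<Sum>k\<in>UNIV. v $ k * cnj (v $ k)) \<noteq> 0"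
proof -
  have "(\<Sum>k\<in>UNIV. v $ k * cnj (v $ k)) = complex_of_real (\<Sum>k\<in>UNIV. (cmod (v $ k))\<^sup>2)"
    by (simp only: of_real_sum complex_norm_square)
  moreover have "(\<Sum>k\<in>UNIV. (cmod (v $ k))\<^sup>2) \<noteq> 0"
    using assms by (subst sum_nonneg_eq_0_iff) (auto simp: vec_eq_iff)
  ultimately show ?thesis by (simp only: of_real_eq_0_iff not_False_eq_True)
qed

lift_definition cproj_embed :: "'n::finite cproj \<Rightarrow> complex^('n option)^('n option)"
  is line_projection
proof -
  fix v w :: "complex^('n option)"
  assume "cproj_rel v w"
  then obtain c where c: "c \<noteq> 0" "w = c *s v" by (auto simp: cproj_rel_def)
  have "(\<Sum>k\<in>UNIV. w $ k * cnj (w $ k)) = (c * cnj c) * (\<Sum>k\<in>UNIV. v $ k * cnj (v $ k))"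
    unfolding c(2) by (simp add: sum_distrib_left mult_ac)
  then show "line_projection v = line_projection w"
    using c by (simp add: line_projection_def vec_eq_iff mult_ac)
qed

lemma cproj_embed_abs: "v \<noteq> 0 \<Longrightarrow> cproj_embed (abs_cproj v) = line_projection v"
  by (simp add: cproj_embed.abs_eq)

lemma inj_cproj_embed: "inj (cproj_embed :: 'n::finite cproj \<Rightarrow> _)"
proof (rule injI)
  fix p q :: "'n cproj"
  assume eq: "cproj_embed p = cproj_embed q"
  obtain v where v: "v \<noteq> 0" "p = abs_cproj v" by (rule cproj_cases)
  obtain w where w: "w \<noteq> 0" "q = abs_cproj w" by (rule cproj_cases)
  define a where "a = (\<Sum>k\<in>UNIV. v $ k * cnj (v $ k))"
  define b where "b = (\<Sum>k\<in>UNIV. w $ k * cnj (w $ k))"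
  have nz: "a \<noteq> 0" "b \<noteq> 0"
    using sum_mult_cnj_nonzero v(1) w(1) by (auto simp: a_def b_def)
  have "line_projection v $ i $ j = line_projection w $ i $ j" for i j
    using eq v w by (simp add: cproj_embed_abs)
  then have *: "v $ i * cnj (v $ j) / a = w $ i * cnj (w $ j) / b" for i j
    by (simp add: line_projection_def a_def b_def)
  obtain j where j: "v $ j \<noteq> 0" using v(1) by (auto simp: vec_eq_iff)
  have wj: "w $ j \<noteq> 0" using *[of j j] j nz by auto
  \<comment> \<open>Column \<open>j\<close> of the common matrix is \<open>cnj (v $ j) / a\<close>
    times \<open>v\<close> and also \<open>cnj (w $ j) / b\<close> times \<open>w\<close>;
    \<open>c\<close> is the quotient of the two factors.\<close>
  define c where "c = cnj (v $ j) * b / (a * cnj (w $ j))"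
  have "c \<noteq> 0" using j wj nz by (simp add: c_def)
  moreover have "w = c *s v"
    using * [of _ j] wj nz by (simp add: vec_eq_iff c_def field_simps)
  ultimately have "cproj_rel v w" using v w by (auto simp: cproj_rel_def)
  then show "p = q"
    unfolding v w by (rule Quotient3_rel_abs[OF Quotient3_cproj])
qed

lemma continuous_on_abs_cproj: "continuous_on (- {0}) (abs_cproj :: _ \<Rightarrow> 'n::finite cproj)"
proof (subst continuous_on_open_vimage)
  show "\<forall>B. open B \<longrightarrow> open ((abs_cproj :: _ \<Rightarrow> 'n cproj) -` B \<inter> - {0})"
  proof (intro allI impI)
    fix B :: "'n cproj set" assume "open B"
    then have "open {v. v \<noteq> 0 \<and> abs_cproj v \<in> B}" by (simp add: open_cproj_def)
    also have "{v. v \<noteq> 0 \<and> abs_cproj v \<in> B} = abs_cproj -` B \<inter> - {0}" by auto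
    finally show "open (abs_cproj -` B \<inter> - {0})" .
  qed
qed auto

text \<open>Every complex line contains a unit vector, so the space is a continuous image of the
  unit sphere.\<close>

lemma compact_UNIV_cproj: "compact (UNIV :: 'n::finite cproj set)"
proof -
  have "p \<in> abs_cproj ` sphere 0 1" for p :: "'n cproj"
  proof -
    obtain v where v: "v \<noteq> 0" "p = abs_cproj v" by (rule cproj_cases)
    define w where "w = complex_of_real (inverse (norm v)) *s v"
    have w': "w = inverse (norm v) *\<^sub>R v"
      unfolding w_def vec_eq_iff by (simp only: vector_smult_component vector_scaleR_component) (simp add: scaleR_conv_of_real)
    have "norm w = 1" using v(1) by (simp add: w')
    then have "w \<noteq> 0" by auto
    have "cproj_rel v w"
      unfolding cproj_rel_def using v(1) \<open>w \<noteq> 0\<close>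
      by (auto simp: w_def intro!: exI[of _ "complex_of_real (inverse (norm v))"])
    then have "p = abs_cproj w"
      unfolding v by (rule Quotient3_rel_abs[OF Quotient3_cproj])
    then show ?thesis using \<open>norm w = 1\<close> by auto
  qed
  then have "UNIV = (abs_cproj ` sphere 0 1 :: 'n cproj set)" by auto
  moreover have "compact (abs_cproj ` sphere 0 1 :: 'n cproj set)"
    by (intro compact_continuous_image continuous_on_subset[OF continuous_on_abs_cproj]) auto
  ultimately show ?thesis by simp
qed

lemma continuous_on_cproj_embed: "continuous_on UNIV (cproj_embed :: 'n::finite cproj \<Rightarrow> _)"
proof -
  have cont: "continuous_on (- {0}) (line_projection :: complex^('n option) \<Rightarrow> _)"
    unfolding line_projection_def
    by (intro continuous_on_vec_lambda continuous_intros ballI) (auto dest!: sum_mult_cnj_nonzero)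
  have "open (cproj_embed -` B :: 'n cproj set)" if "open B" for B
  proof -
    have "{v. v \<noteq> 0 \<and> abs_cproj v \<in> (cproj_embed -` B :: 'n cproj set)} = line_projection -` B \<inter> - {0}"
      by (auto simp: cproj_embed_abs)
    moreover have "open (line_projection -` B \<inter> - {0 :: complex^('n option)})"
      using continuous_on_open_vimage[of "- {0}"] cont that by (metis open_Compl closed_singleton)
    ultimately show ?thesis by (simp add: open_cproj_def)
  qed
  then show ?thesis by (simp add: continuous_on_open_vimage)
qed

text \<open>A continuous injection of a compact space into a Hausdorff space is an embedding: the
  image of the closed set \<open>- U\<close> is compact, and the complement of this image serves as
  \<open>V\<close>.\<close>

lemma open_cproj_embed_iff:
  "open (U :: 'n::finite cproj set) \<longleftrightarrow> (\<exists>V. open V \<and> U = cproj_embed -` V)"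
proof
  assume "open U"
  then have "compact (- U)"
    using closed_Int_compact[of "- U" UNIV] compact_UNIV_cproj by auto
  then have "compact (cproj_embed ` (- U))"
    by (rule compact_continuous_image[rotated]) (rule continuous_on_subset[OF continuous_on_cproj_embed], simp)
  then have "open (- (cproj_embed ` (- U)))" by (simp add: compact_imp_closed open_Compl)
  moreover have "U = cproj_embed -` (- (cproj_embed ` (- U)))"
    using inj_cproj_embed by (auto dest: injD)
  ultimately show "\<exists>V. open V \<and> U = cproj_embed -` V" by blast
qed (use continuous_on_cproj_embed in \<open>auto simp: continuous_on_open_vimage\<close>)

text \<open>The quotient topology is already fixed, so the distance must generate exactly this
  topology, which is \<open>open_cproj_embed_iff\<close>. The metric \<open>d\<close> of the theorem
  is arbitrary and is linked to this distance only through the topology.\<close>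

instantiation cproj :: (finite) metric_space
begin

definition dist_cproj :: "'a cproj \<Rightarrow> 'a cproj \<Rightarrow> real"
  where "dist_cproj p q = dist (cproj_embed p) (cproj_embed q)"

definition uniformity_cproj :: "('a cproj \<times> 'a cproj) filter"
  where "uniformity_cproj = (INF e\<in>{0 <..}. principal {(p, q). dist p q < e})"

instance
proof
  show "dist p q = 0 \<longleftrightarrow> p = q" for p q :: "'a cproj"
    using inj_cproj_embed by (auto simp: dist_cproj_def dest: injD)
  show "dist p q \<le> dist p r + dist q r" for p q r :: "'a cproj"
    unfolding dist_cproj_def by (rule dist_triangle2)
  show "open U \<longleftrightarrow> (\<forall>p\<in>U. \<forall>\<^sub>F (p', q) in uniformity. p' = p \<longrightarrow> q \<in> U)" for U :: "'a cproj set"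
  proof -
    have "open U \<longleftrightarrow> (\<forall>p\<in>U. \<exists>e>0. \<forall>q. dist p q < e \<longrightarrow> q \<in> U)"
    proof
      assume "open U"
      then obtain V where V: "open V" "U = cproj_embed -` V"
        unfolding open_cproj_embed_iff by blast
      show "\<forall>p\<in>U. \<exists>e>0. \<forall>q. dist p q < e \<longrightarrow> q \<in> U"
      proof
        fix p assume "p \<in> U"
        then obtain e where "e > 0" "ball (cproj_embed p) e \<subseteq> V"
          using V openE by (metis vimage_eq)
        then show "\<exists>e>0. \<forall>q. dist p q < e \<longrightarrow> q \<in> U"
          unfolding dist_cproj_def V(2) by (intro exI[of _ e]) auto
      qed
    next
      assume *: "\<forall>p\<in>U. \<exists>e>0. \<forall>q. dist p q < e \<longrightarrow> q \<in> U"
      then obtain e where e: "\<And>p. p \<in> U \<Longrightarrow> e p > 0"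
        "\<And>p q. p \<in> U \<Longrightarrow> dist p q < e p \<Longrightarrow> q \<in> U" by metis
      have "p \<in> cproj_embed -` (\<Union>p\<in>U. ball (cproj_embed p) (e p))" if "p \<in> U" for p
        using e(1)[OF that] that by (intro vimageI2 UN_I[of p]) auto
      moreover have "q \<in> U" if "q \<in> cproj_embed -` (\<Union>p\<in>U. ball (cproj_embed p) (e p))" for q
        using that e(2) by (auto simp: dist_cproj_def)
      ultimately have "U = cproj_embed -` (\<Union>p\<in>U. ball (cproj_embed p) (e p))" by blast
      moreover have "open (\<Union>p\<in>U. ball (cproj_embed p) (e p))" by auto
      ultimately show "open U" unfolding open_cproj_embed_iff by blast
    qed
    also have "\<dots> \<longleftrightarrow> (\<forall>p\<in>U. \<forall>\<^sub>F (p', q) in uniformity. p' = p \<longrightarrow> q \<in> U)"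
      unfolding uniformity_cproj_def
      by (subst eventually_INF_base)
        (auto simp: eventually_principal Bex_def subset_eq dist_commute intro: exI[of _ "min _ _"])
    finally show ?thesis .
  qed
qed (rule uniformity_cproj_def)

end

instance cproj :: (finite) second_countable_topology
proof
  obtain B :: "(complex^('a option)^('a option)) set set" where B: "countable B" "topological_basis B"
    using ex_countable_basis by blast
  have "topological_basis ((-`) cproj_embed ` B :: 'a cproj set set)"
  proof (rule topological_basisI)
    show "open U" if "U \<in> (-`) cproj_embed ` B" for U :: "'a cproj set"
      using that B(2) by (auto simp: open_cproj_embed_iff intro: topological_basis_open)
    fix U :: "'a cproj set" and p assume "open U" "p \<in> U"
    then obtain V where "open V" "U = cproj_embed -` V" by (auto simp: open_cproj_embed_iff)
    with \<open>p \<in> U\<close> topological_basisE[OF B(2), of V "cproj_embed p"]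
    show "\<exists>W\<in>(-`) cproj_embed ` B. p \<in> W \<and> W \<subseteq> U" by (metis imageI vimage_eq vimage_mono)
  qed
  then show "\<exists>B :: 'a cproj set set. countable B \<and> open = generate_topology B"
    using B(1) topological_basis_imp_subbasis by blast
qed

instance cproj :: (finite) complete_space
proof
  fix X :: "nat \<Rightarrow> 'a cproj" assume "Cauchy X"
  then show "convergent X"
    using compact_imp_complete[OF compact_UNIV_cproj] by (auto simp: complete_def convergent_def)
qed

instance cproj :: (finite) polish_space ..

subsection \<open>Probability measures on a compact metric space\<close>

lemma continuous_imp_bounded_compact_UNIV:
  fixes \<phi> :: "'a::topological_space \<Rightarrow> real"
  assumes "compact (UNIV :: 'a set)" "continuous_on UNIV \<phi>"
  obtains B where "\<And>x. \<bar>\<phi> x\<bar> \<le> B"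
  using compact_imp_bounded[OF compact_continuous_image[OF assms(2,1)]]
  by (auto simp: bounded_iff)

lemma integrable_continuous_compact_UNIV:
  fixes \<phi> :: "'a::topological_space \<Rightarrow> real"
  assumes "compact (UNIV :: 'a set)" "continuous_on UNIV \<phi>" "prob_space \<mu>" "sets \<mu> = sets borel"
  shows "integrable \<mu> \<phi>"
proof -
  interpret prob_space \<mu> by fact
  obtain B where B: "\<And>x. \<bar>\<phi> x\<bar> \<le> B"
    using continuous_imp_bounded_compact_UNIV[OF assms(1,2)] by blast
  have "\<phi> \<in> borel_measurable \<mu>"
    using borel_measurable_continuous_onI[OF assms(2)] assms(4) by (simp cong: measurable_cong_sets)
  with B show ?thesis by (intro integrable_const_bound[of _ B]) auto
qed

lemma compact_UNIV_pair_subsequence: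
  fixes y y' :: "nat \<Rightarrow> 'a::metric_space"
  assumes "compact (UNIV :: 'a set)"
  obtains a b r where "strict_mono r" "(y \<circ> r) \<longlonglongrightarrow> a" "(y' \<circ> r) \<longlonglongrightarrow> b"
proof -
  have "compact (UNIV :: ('a \<times> 'a) set)" using compact_Times[OF assms assms] by simp
  then obtain l r where "strict_mono (r :: nat \<Rightarrow> nat)" "((\<lambda>k. (y k, y' k)) \<circ> r) \<longlonglongrightarrow> l"
    by (auto simp: compact_def) (metis UNIV_I)
  then show thesis
    using tendsto_fst[of _ l] tendsto_snd[of _ l] that[of r "fst l" "snd l"] by (fastforce simp: o_def)
qed

text \<open>The ternary digits of \<open>s y\<close> record which members of a countable base contain \<open>y\<close>.\<close>

lemma compact_metric_real_code:
  assumes comp: "compact (UNIV :: 'a::{metric_space,second_countable_topology} set)"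
  obtains s :: "'a::{metric_space,second_countable_topology} \<Rightarrow> real" where "s \<in> borel_measurable borel" "range s \<subseteq> {0..3/2}" "inj s"
    "uniformly_continuous_on (range s) (inv s)"
proof -
  obtain \<B> :: "'a set set" where \<B>: "countable \<B>" "topological_basis \<B>"
    using ex_countable_basis by blast
  have "\<B> \<noteq> {}" using topological_basisE[OF \<B>(2) open_UNIV UNIV_I] by blast
  define U where "U = from_nat_into \<B>"
  have range_U: "range U = \<B>" unfolding U_def using \<open>\<B> \<noteq> {}\<close> \<B>(1) by (rule range_from_nat_into)
  have open_U: "open (U n)" for n using \<B>(2) range_U topological_basis_open by blast
  \<comment> \<open>With ratio 1/3 all digits after the \<open>n\<close>-th sum to at most
    \<open>(1/3) ^ n / 2\<close>, half of the \<open>n\<close>-th weight, so the first differing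
    digit leaves a gap. With ratio 1/2 the gap would vanish.\<close>
  define t where "t n y = (indicator (U n) y :: real) * (1/3) ^ n" for n y
  define s where "s y = (\<Sum>n. t n y)" for y
  have geo: "(\<lambda>n. (1/3 :: real) ^ n) sums (3/2)"
    using geometric_sums[of "1/3 :: real"] by simp
  have t_nonneg: "0 \<le> t n y" and t_le: "t n y \<le> (1/3) ^ n" for n y
    by (auto simp: t_def indicator_def)
  have summable_t: "summable (\<lambda>n. t n y)" for y
    by (rule summable_comparison_test[OF _ sums_summable[OF geo]]) (use t_nonneg t_le in auto)
  have t_meas: "t n \<in> borel_measurable borel" for n
    unfolding t_def using open_U by simp
  have s_meas: "s \<in> borel_measurable borel"
    unfolding s_def by (rule borel_measurable_suminf) (rule t_meas)
  have "0 \<le> s y" for y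
    unfolding s_def by (rule suminf_nonneg[OF summable_t t_nonneg])
  moreover have "s y \<le> 3/2" for y
    unfolding s_def by (subst sums_unique[OF geo], rule suminf_le[OF t_le summable_t sums_summable[OF geo]])
  ultimately have range_s: "range s \<subseteq> {0..3/2}" by auto
  have sep_least: "(1/3) ^ n / 2 \<le> \<bar>s y - s y'\<bar>"
    if n: "y \<in> U n \<longleftrightarrow> y' \<notin> U n" and less: "\<And>i. i < n \<Longrightarrow> y \<in> U i \<longleftrightarrow> y' \<in> U i" for n y y'
  proof -
    define a where "a i = t i y - t i y'" for i
    have sa: "summable a" unfolding a_def by (intro summable_diff summable_t)
    have "s y - s y' = (\<Sum>i. a i)"
      unfolding s_def a_def using suminf_diff[OF summable_t summable_t] by simp
    also have "\<dots> = (\<Sum>i. a (i + Suc n)) + (\<Sum>i<Suc n. a i)"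
      by (rule suminf_split_initial_segment[OF sa])
    also have "(\<Sum>i<Suc n. a i) = a n"
      using less by (simp add: a_def t_def indicator_def)
    finally have eq: "s y - s y' = (\<Sum>i. a (i + Suc n)) + a n" .
    have an: "\<bar>a n\<bar> = (1/3) ^ n" using n by (auto simp: a_def t_def indicator_def)
    have geo': "(\<lambda>i. (1/3 :: real) ^ (i + Suc n)) sums ((1/3) ^ n / 2)"
      using sums_mult[OF geo, of "(1/3) ^ Suc n"] by (simp add: power_add mult_ac)
    have abs_a: "\<bar>a i\<bar> \<le> (1/3) ^ i" for i
      using t_nonneg[of i y] t_le[of i y] t_nonneg[of i y'] t_le[of i y'] unfolding a_def by linarith
    have "norm (\<Sum>i. a (i + Suc n)) \<le> (\<Sum>i. (1/3 :: real) ^ (i + Suc n))"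
      by (rule norm_suminf_le[OF _ sums_summable[OF geo']]) (simp only: real_norm_def abs_a)
    also have "\<dots> = (1/3) ^ n / 2" using sums_unique[OF geo'] by simp
    finally have "\<bar>\<Sum>i. a (i + Suc n)\<bar> \<le> (1/3) ^ n / 2" by simp
    then show ?thesis unfolding eq using an by linarith
  qed
  \<comment> \<open>The least separating index is at most \<open>n\<close>, and its gap is at least
    as large.\<close>
  have sep: "(1/3) ^ n / 2 \<le> \<bar>s y - s y'\<bar>" if n: "y \<in> U n \<longleftrightarrow> y' \<notin> U n" for n y y'
  proof -
    define m where "m = (LEAST n. y \<in> U n \<longleftrightarrow> y' \<notin> U n)"
    have "y \<in> U m \<longleftrightarrow> y' \<notin> U m" unfolding m_def by (rule LeastI) (rule n)
    moreover have "y \<in> U i \<longleftrightarrow> y' \<in> U i" if "i < m" for i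
      using not_less_Least[of i] that unfolding m_def by blast
    ultimately have "(1/3) ^ m / 2 \<le> \<bar>s y - s y'\<bar>" by (rule sep_least)
    moreover have "m \<le> n" unfolding m_def by (rule Least_le) (rule n)
    then have "(1/3 :: real) ^ n \<le> (1/3) ^ m" by (intro power_decreasing) auto
    ultimately show ?thesis by linarith
  qed
  have base: "\<exists>n. a \<in> U n \<and> U n \<subseteq> W" if "open W" "a \<in> W" for a W
    using topological_basisE[OF \<B>(2) that] range_U by (metis imageE)
  have inj_s: "inj s"
  proof (rule injI, rule ccontr)
    fix y y' assume "s y = s y'" "y \<noteq> y'"
    obtain n where "y \<in> U n" "U n \<subseteq> - {y'}"
      using base[of "- {y'}" y] \<open>y \<noteq> y'\<close> by auto
    then have "(1/3) ^ n / 2 \<le> \<bar>s y - s y'\<bar>" by (intro sep) auto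
    moreover have "(0 :: real) < (1/3) ^ n" by simp
    ultimately show False using \<open>s y = s y'\<close> by linarith
  qed
  have "uniformly_continuous_on (range s) (inv s)"
  proof (rule ccontr)
    assume "\<not> uniformly_continuous_on (range s) (inv s)"
    then obtain e where e: "e > 0" "\<And>\<delta>. \<delta> > 0 \<Longrightarrow> \<exists>x\<in>range s. \<exists>x'\<in>range s. dist x' x < \<delta> \<and> \<not> dist (inv s x') (inv s x) < e"
      unfolding uniformly_continuous_on_def by blast
    have "\<exists>y y'. \<bar>s y' - s y\<bar> < inverse (Suc k) \<and> e \<le> dist y' y" for k
      using e(2)[of "inverse (Suc k)"] inj_s by (auto simp: dist_real_def not_less)
    then obtain y y' where y: "\<And>k. \<bar>s (y' k) - s (y k)\<bar> < inverse (Suc k)" "\<And>k. e \<le> dist (y' k) (y k)"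
      by metis
    obtain a b r where r: "strict_mono r" and a: "(y \<circ> r) \<longlonglongrightarrow> a" and b: "(y' \<circ> r) \<longlonglongrightarrow> b"
      using compact_UNIV_pair_subsequence[OF comp] by metis
    have ab: "e \<le> dist b a"
      by (rule tendsto_lowerbound[OF tendsto_dist[OF b a]]) (use y(2) in \<open>auto simp: o_def\<close>)
    \<comment> \<open>The limits \<open>a\<close> and \<open>b\<close> are at least \<open>e\<close>
      apart, so \<open>U n\<close> eventually contains the points near \<open>a\<close> and misses
      those near \<open>b\<close>. The fixed digit \<open>n\<close> then keeps apart codes that were
      supposed to approach each other.\<close>
    obtain n where n: "a \<in> U n" "U n \<subseteq> ball a (e/2)"
      using base[of "ball a (e/2)" a] e(1) by auto
    have "\<forall>\<^sub>F k in sequentially. (y \<circ> r) k \<in> U n"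
      by (rule topological_tendstoD[OF a open_U n(1)])
    moreover have "\<forall>\<^sub>F k in sequentially. (y' \<circ> r) k \<in> ball b (e/2)"
      by (rule topological_tendstoD[OF b]) (use e(1) in auto)
    moreover have "\<forall>\<^sub>F k in sequentially. inverse (Suc k) < (1/3 :: real) ^ n / 2"
      using order_tendstoD(2)[OF LIMSEQ_inverse_real_of_nat, of "(1/3) ^ n / 2"] by simp
    ultimately have "\<forall>\<^sub>F k in sequentially. False"
    proof eventually_elim
      case (elim k)
      have "(y' \<circ> r) k \<notin> U n"
      proof
        assume "(y' \<circ> r) k \<in> U n"
        then have "dist a ((y' \<circ> r) k) < e/2" using n(2) by auto
        moreover have "dist b ((y' \<circ> r) k) < e/2" using elim(2) by simp
        ultimately show False using ab dist_triangle_half_l[of b "(y' \<circ> r) k" e a]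
          by (simp add: dist_commute)
      qed
      then have "(1/3) ^ n / 2 \<le> \<bar>s (y' (r k)) - s (y (r k))\<bar>"
        using sep[of "y' (r k)" n "y (r k)"] elim(1) by auto
      also have "\<dots> < inverse (Suc (r k))" by (rule y(1))
      also have "\<dots> \<le> inverse (Suc k)"
        using seq_suble[OF r, of k] by (simp add: le_imp_inverse_le)
      finally show False using elim(3) by linarith
    qed
    then show False by simp
  qed
  with s_meas range_s inj_s show thesis by (rule that)
qed

text \<open>The laws of the codes live in a bounded interval and have a weakly convergent
  subsequence on the line. As \<open>s\<close> may be discontinuous, the limit \<open>N\<close> may
  charge points outside \<open>range s\<close>; it is still carried by the closure, to which the
  decoding map extends. The image of \<open>N\<close> under the extension is the limit
  sought.\<close>

lemma prob_measures_weakly_sequentially_compact: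
  fixes \<mu> :: "nat \<Rightarrow> 'a::polish_space measure"
  assumes comp: "compact (UNIV :: 'a set)"
    and \<mu>: "\<And>n. prob_space (\<mu> n)" "\<And>n. sets (\<mu> n) = sets borel"
  obtains r \<nu> where "strict_mono (r :: nat \<Rightarrow> nat)" "prob_space \<nu>" "sets \<nu> = sets borel"
    "\<And>\<phi> :: 'a \<Rightarrow> real. continuous_on UNIV \<phi> \<Longrightarrow>
       (\<lambda>n. integral\<^sup>L (\<mu> (r n)) \<phi>) \<longlonglongrightarrow> integral\<^sup>L \<nu> \<phi>"
proof -
  obtain s :: "'a \<Rightarrow> real" where s: "s \<in> borel_measurable borel" "range s \<subseteq> {0..3/2}" "inj s"
    "uniformly_continuous_on (range s) (inv s)"
    using compact_metric_real_code[OF comp] by blast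
  obtain g where g: "uniformly_continuous_on (closure (range s)) g" "\<And>x. x \<in> range s \<Longrightarrow> inv s x = g x"
    using uniformly_continuous_on_extension_on_closure[OF s(4)] by metis
  have gs: "g (s y) = y" for y using g(2)[of "s y"] s(3) by simp
  define C where "C = closure (range s)"
  have C: "closed C" "C \<noteq> {}" "s y \<in> C" for y
    using closure_subset[of "range s"] by (auto simp: C_def)
  have cont_g: "continuous_on C g"
    unfolding C_def by (rule uniformly_continuous_imp_continuous[OF g(1)])
  have s_meas: "s \<in> borel_measurable (\<mu> n)" for n
    using s(1) \<mu>(2) by (simp cong: measurable_cong_sets)
  define M where "M n = distr (\<mu> n) borel s" for n
  have M: "real_distribution (M n)" for n
    unfolding M_def by (rule prob_space.real_distribution_distr[OF \<mu>(1) s_meas])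
  have "tight M"
    unfolding tight_def
  proof (intro conjI allI impI)
    fix e :: real assume "e > 0"
    \<comment> \<open>All codes lie between 0 and 3/2, hence in this half-open interval.\<close>
    have "measure (M n) {-1<..2} = 1" for n
    proof -
      interpret prob_space "\<mu> n" by (rule \<mu>)
      have "-1 < s y \<and> s y \<le> 2" for y
        using range_subsetD[OF s(2), of y] by simp
      then have "s -` {-1<..2} \<inter> space (\<mu> n) = space (\<mu> n)"
        by auto
      then show ?thesis unfolding M_def using s_meas prob_space by (subst measure_distr) auto
    qed
    then show "\<exists>a b. a < b \<and> (\<forall>n. 1 - e < measure (M n) {a<..b})"
      using \<open>e > 0\<close> by (intro exI[of _ "-1"] exI[of _ 2]) auto
  qed (rule M)
  then obtain r N where r: "strict_mono (r :: nat \<Rightarrow> nat)" and N: "real_distribution N"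
    and conv: "weak_conv_m (M \<circ> r) N"
    using tight_imp_convergent_subsubsequence[of M id] by (auto simp: strict_mono_id)
  interpret N: real_distribution N by fact
  have MN: "real_distribution ((M \<circ> r) n)" for n using M by simp
  have lim: "(\<lambda>n. \<integral>x. \<psi> (s x) \<partial>\<mu> (r n)) \<longlonglongrightarrow> integral\<^sup>L N \<psi>"
    if \<psi>: "continuous_on UNIV \<psi>" "\<And>x. norm (\<psi> x) \<le> B" for \<psi> :: "real \<Rightarrow> real" and B
  proof -
    have "(\<lambda>n. integral\<^sup>L ((M \<circ> r) n) \<psi>) \<longlonglongrightarrow> integral\<^sup>L N \<psi>"
      by (rule weak_conv_imp_integral_bdd_continuous_conv[OF MN N conv])
        (use \<psi> in \<open>auto simp: continuous_on_eq_continuous_at\<close>)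
    moreover have "integral\<^sup>L ((M \<circ> r) n) \<psi> = (\<integral>x. \<psi> (s x) \<partial>\<mu> (r n))" for n
      unfolding M_def o_def
      by (rule integral_distr[OF s_meas borel_measurable_continuous_onI[OF \<psi>(1)]])
    ultimately show ?thesis by simp
  qed
  have "AE x in N. x \<in> C"
  proof -
    \<comment> \<open>A bounded continuous function whose zero set is \<open>C\<close>: it vanishes
      on all codes, so its integral against the limit is 0.\<close>
    define h where "h x = min 1 (infdist x C)" for x
    have h: "continuous_on UNIV h" "\<And>x. norm (h x) \<le> 1" "\<And>y. h (s y) = 0"
      using C(3) by (auto simp: h_def infdist_nonneg intro!: continuous_intros)
    have h_meas: "h \<in> borel_measurable N"
      using borel_measurable_continuous_onI[OF h(1)] by simp
    have "integral\<^sup>L N h = 0"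
      using lim[OF h(1,2)] h(3) LIMSEQ_const_iff[of "0::real"] by simp
    moreover have "integrable N h" by (rule N.integrable_const_bound[of _ 1]) (use h h_meas in auto)
    ultimately have "AE x in N. h x = 0"
      by (subst (asm) integral_nonneg_eq_0_iff_AE) (auto simp: h_def infdist_nonneg)
    then show ?thesis
      by eventually_elim (use C in_closed_iff_infdist_zero in \<open>auto simp: h_def min_def split: if_splits\<close>)
  qed
  \<comment> \<open>The value off \<open>C\<close> is immaterial, since \<open>N\<close> is carried
    by \<open>C\<close>; it is constant there to make \<open>g'\<close> measurable.\<close>
  define g' where "g' x = (if x \<in> C then g x else undefined)" for x
  have g': "g' \<in> borel_measurable N"
    unfolding g'_def using borel_measurable_continuous_on_if[OF borel_closed[OF C(1)] cont_g, of "\<lambda>_. undefined"]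
    by (simp add: N.events_eq_borel cong: measurable_cong_sets)
  define \<nu> where "\<nu> = distr N borel g'"
  have "(\<lambda>n. integral\<^sup>L (\<mu> (r n)) \<phi>) \<longlonglongrightarrow> integral\<^sup>L \<nu> \<phi>" if \<phi>: "continuous_on UNIV \<phi>" for \<phi> :: "'a \<Rightarrow> real"
  proof -
    obtain B where B: "\<And>x. \<bar>\<phi> x\<bar> \<le> B"
      using continuous_imp_bounded_compact_UNIV[OF comp \<phi>] by blast
    have "0 \<le> B" using B[of undefined] by linarith
    have "continuous_on C (\<lambda>x. \<phi> (g x))"
      by (rule continuous_on_compose2[OF \<phi> cont_g]) auto
    \<comment> \<open>Tietze's extension keeps the bound \<open>B\<close>, so weak convergence on
      the line applies to it.\<close>
    then obtain \<psi> where \<psi>: "continuous_on UNIV \<psi>" "\<And>x. x \<in> C \<Longrightarrow> \<psi> x = \<phi> (g x)" "\<And>x. norm (\<psi> x) \<le> B"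
      using Tietze[of C "\<lambda>x. \<phi> (g x)" UNIV B] C(1) \<open>0 \<le> B\<close> B by auto
    have "integral\<^sup>L \<nu> \<phi> = (\<integral>x. \<phi> (g' x) \<partial>N)"
      unfolding \<nu>_def by (rule integral_distr[OF g' borel_measurable_continuous_onI[OF \<phi>]])
    also have "\<dots> = integral\<^sup>L N \<psi>"
    proof (rule integral_cong_AE)
      show "(\<lambda>x. \<phi> (g' x)) \<in> borel_measurable N"
        using measurable_compose[OF g' borel_measurable_continuous_onI[OF \<phi>]] .
      show "\<psi> \<in> borel_measurable N"
        using borel_measurable_continuous_onI[OF \<psi>(1)] by simp
      show "AE x in N. \<phi> (g' x) = \<psi> x"
        using \<open>AE x in N. x \<in> C\<close> by eventually_elim (simp add: g'_def \<psi>)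
    qed
    finally show ?thesis using lim[OF \<psi>(1,3)] \<psi>(2) C(3) gs by simp
  qed
  moreover have "prob_space \<nu>" "sets \<nu> = sets borel"
    unfolding \<nu>_def using N.prob_space_distr[OF g'] by auto
  ultimately show thesis using r that by blast
qed

text \<open>The closed sets are stable under intersection and generate the Borel sets, and the
  indicator of a closed set is a pointwise limit of continuous functions with values between 0 and
  1.\<close>

lemma measure_eqI_integral_continuous:
  fixes \<mu> \<nu> :: "'a::metric_space measure"
  assumes \<mu>: "prob_space \<mu>" "sets \<mu> = sets borel" and \<nu>: "prob_space \<nu>" "sets \<nu> = sets borel"
    and eq: "\<And>\<phi> :: 'a \<Rightarrow> real. continuous_on UNIV \<phi> \<Longrightarrow> (\<And>x. \<bar>\<phi> x\<bar> \<le> 1) \<Longrightarrow>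
      integral\<^sup>L \<mu> \<phi> = integral\<^sup>L \<nu> \<phi>"
  shows "\<mu> = \<nu>"
proof (rule measure_eqI_generator_eq[where E = "Collect closed" and \<Omega> = UNIV and A = "\<lambda>_. UNIV"])
  interpret \<mu>: prob_space \<mu> by fact
  interpret \<nu>: prob_space \<nu> by fact
  fix A :: "'a set" assume "A \<in> Collect closed"
  then have A: "closed A" by simp
  define h where "h n x = max 0 (1 - real n * infdist x A)" for n x
  have h: "continuous_on UNIV (h n)" "\<bar>h n x\<bar> \<le> 1" for n x
    unfolding h_def by (auto intro!: continuous_intros mult_nonneg_nonneg infdist_nonneg)
  show "emeasure \<mu> A = emeasure \<nu> A"
  \<comment> \<open>\<open>infdist x {}\<close> is 0, so for empty \<open>A\<close> the functions
    \<open>h n\<close> would be constantly 1 instead of tending to the indicator.\<close>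
  proof (cases "A = {}")
    case False
    have h_lim: "(\<lambda>n. h n x) \<longlonglongrightarrow> indicator A x" for x
    proof (cases "x \<in> A")
      case True
      then show ?thesis by (simp add: h_def)
    next
      case x: False
      then have pos: "infdist x A > 0"
        using in_closed_iff_infdist_zero[OF A False, of x] infdist_nonneg[of x A] by linarith
      then obtain m where m: "1 < real m * infdist x A" using reals_Archimedean3 by blast
      have "h n x = 0" if "m \<le> n" for n
      proof -
        have "real m * infdist x A \<le> real n * infdist x A"
          using that pos by (intro mult_right_mono) auto
        with m show ?thesis by (simp add: h_def)
      qed
      then have "\<forall>\<^sub>F n in sequentially. h n x = 0" unfolding eventually_sequentially by blast
      then show ?thesis using x by (simp add: tendsto_eventually)
    qed
    have lim: "(\<lambda>n. integral\<^sup>L \<kappa> (h n)) \<longlonglongrightarrow> measure \<kappa> A"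
      if \<kappa>: "prob_space \<kappa>" "sets \<kappa> = sets borel" for \<kappa>
    proof -
      interpret prob_space \<kappa> by fact
      have "(\<lambda>n. integral\<^sup>L \<kappa> (h n)) \<longlonglongrightarrow> integral\<^sup>L \<kappa> (indicator A)"
      proof (rule integral_dominated_convergence[where w = "\<lambda>_. 1"])
        show "h n \<in> borel_measurable \<kappa>" for n
          using borel_measurable_continuous_onI[OF h(1)] \<kappa>(2) by (simp cong: measurable_cong_sets)
        show "indicat_real A \<in> borel_measurable \<kappa>"
          using A \<kappa>(2) by (intro borel_measurable_indicator) simp
      qed (use h h_lim in auto)
      then show ?thesis using A \<kappa> by (simp add: sets_eq_imp_space_eq)
    qed
    have "measure \<mu> A = measure \<nu> A"
      using LIMSEQ_unique[OF lim[OF \<mu>] ] lim[OF \<nu>] eq[OF h] by simp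
    then show ?thesis by (simp add: \<mu>.emeasure_eq_measure \<nu>.emeasure_eq_measure)
  qed simp
next
  interpret \<mu>: prob_space \<mu> by fact
  show "emeasure \<mu> UNIV \<noteq> \<infinity>" for i :: nat by simp
qed (use \<mu> \<nu> in \<open>auto simp: Int_stable_def borel_eq_closed\<close>)

text \<open>The weak topology is given by a subbase. Lying eventually in a set is inherited by
  finite intersections and by unions, so it need only be checked on the generating sets.\<close>

lemma limitin_weak_topologyI:
  assumes "\<nu> \<in> prob_measures X" "\<And>n. \<mu> n \<in> prob_measures X"
    and conv: "\<And>\<phi>. continuous_map X euclideanreal \<phi> \<Longrightarrow> bounded (\<phi> ` topspace X) \<Longrightarrow>
      ((\<lambda>n. integral\<^sup>L (\<mu> n) \<phi>) \<longlongrightarrow> integral\<^sup>L \<nu> \<phi>) F"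
  shows "limitin (weak_topology X) \<mu> \<nu> F"
  unfolding limitin_def
proof (intro conjI allI impI)
  show "\<nu> \<in> topspace (weak_topology X)" using assms(1) by (simp add: topspace_weak_topology)
  fix U assume "openin (weak_topology X) U \<and> \<nu> \<in> U"
  then have gen: "generate_topology_on {{\<mu> \<in> prob_measures X. integral\<^sup>L \<mu> \<phi> \<in> V} | \<phi> V.
      continuous_map X euclideanreal \<phi> \<and> bounded (\<phi> ` topspace X) \<and> open V} U" and "\<nu> \<in> U"
    by (auto simp: weak_topology_def openin_topology_generated_by_iff)
  from gen \<open>\<nu> \<in> U\<close> show "\<forall>\<^sub>F n in F. \<mu> n \<in> U"
  proof induction
    case (Int a b)
    then have "\<forall>\<^sub>F n in F. \<mu> n \<in> a" "\<forall>\<^sub>F n in F. \<mu> n \<in> b" by auto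
    then show ?case by eventually_elim auto
  next
    case (UN K)
    then obtain k where "k \<in> K" "\<forall>\<^sub>F n in F. \<mu> n \<in> k" by auto
    then show ?case by (auto elim!: eventually_mono)
  next
    case (Basis W)
    then obtain \<phi> V where \<phi>: "W = {\<mu> \<in> prob_measures X. integral\<^sup>L \<mu> \<phi> \<in> V}"
      "continuous_map X euclideanreal \<phi>" "bounded (\<phi> ` topspace X)" "open V" by blast
    then have "\<forall>\<^sub>F n in F. integral\<^sup>L (\<mu> n) \<phi> \<in> V"
      using topological_tendstoD[OF conv[OF \<phi>(2,3)] \<phi>(4)] Basis(2) by auto
    then show ?case using assms(2) by (auto simp: \<phi>(1))
  qed simp
qed

lemma limitin_weak_topologyD:
  assumes "limitin (weak_topology X) \<mu> \<nu> F" "continuous_map X euclideanreal \<phi>" "bounded (\<phi> ` topspace X)"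
  shows "((\<lambda>n. integral\<^sup>L (\<mu> n) \<phi>) \<longlongrightarrow> integral\<^sup>L \<nu> \<phi>) F"
proof (rule topological_tendstoI)
  fix V assume V: "open V" "integral\<^sup>L \<nu> \<phi> \<in> V"
  have "openin (weak_topology X) {\<mu> \<in> prob_measures X. integral\<^sup>L \<mu> \<phi> \<in> V}"
    unfolding weak_topology_def using assms(2,3) V(1) by (intro topology_generated_by_Basis) blast
  moreover have "\<nu> \<in> prob_measures X"
    using limitin_topspace[OF assms(1)] by (simp add: topspace_weak_topology)
  ultimately show "\<forall>\<^sub>F n in F. integral\<^sup>L (\<mu> n) \<phi> \<in> V"
    using assms(1) V(2) by (auto simp: limitin_def elim!: allE[of _ "{\<mu> \<in> prob_measures X. integral\<^sup>L \<mu> \<phi> \<in> V}"] eventually_mono)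
qed

text \<open>A partition of unity subordinate to small balls reduces the family to finitely many test
  functions.\<close>

lemma weak_convergence_uniform_on_equicontinuous:
  fixes f :: "'k \<Rightarrow> 'a::metric_space \<Rightarrow> real"
  assumes comp: "compact (UNIV :: 'a set)"
    and \<mu>: "\<And>n. prob_space (\<mu> n)" "\<And>n. sets (\<mu> n) = sets borel"
    and \<nu>: "prob_space \<nu>" "sets \<nu> = sets borel"
    and conv: "\<And>\<phi> :: 'a \<Rightarrow> real. continuous_on UNIV \<phi> \<Longrightarrow>
      (\<lambda>n. integral\<^sup>L (\<mu> n) \<phi>) \<longlonglongrightarrow> integral\<^sup>L \<nu> \<phi>"
    and bdd: "\<And>k y. \<bar>f k y\<bar> \<le> B"
    and equi: "\<And>z e. e > 0 \<Longrightarrow> \<exists>\<delta>>0. \<forall>y k. dist z y < \<delta> \<longrightarrow> \<bar>f k z - f k y\<bar> < e"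
    and "e > 0"
  shows "\<forall>\<^sub>F n in sequentially. \<forall>k. \<bar>integral\<^sup>L (\<mu> n) (f k) - integral\<^sup>L \<nu> (f k)\<bar> < e"
proof -
  have "e / 4 > 0" using \<open>e > 0\<close> by simp
  from equi[OF this] obtain \<delta> where \<delta>: "\<And>z. \<delta> z > 0"
    "\<And>z y k. dist z y < \<delta> z \<Longrightarrow> \<bar>f k z - f k y\<bar> < e / 4" by metis
  obtain X where X: "finite X" "UNIV \<subseteq> (\<Union>x\<in>X. ball x (\<delta> x))"
  proof (rule compactE_image[OF comp, of UNIV "\<lambda>x. ball x (\<delta> x)"])
    have "x \<in> ball x (\<delta> x)" for x using \<delta>(1) by simp
    then show "UNIV \<subseteq> (\<Union>x\<in>UNIV. ball x (\<delta> x))" by blast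
  qed (rule open_ball, blast)
  define h where "h x y = max 0 (\<delta> x - dist x y)" for x y
  define H where "H y = (\<Sum>x\<in>X. h x y)" for y
  define p where "p x y = h x y / H y" for x y
  have H_pos: "H y > 0" for y
  proof -
    have "y \<in> (\<Union>x\<in>X. ball x (\<delta> x))" using X(2) by blast
    then obtain x where "x \<in> X" "dist x y < \<delta> x" by auto
    then show ?thesis unfolding H_def using X(1)
      by (intro sum_pos2[of X x]) (auto simp: h_def)
  qed
  have p_cont: "continuous_on UNIV (p x)" for x
    unfolding p_def H_def h_def
    using H_pos by (intro continuous_intros) (auto simp: H_def h_def less_imp_neq[symmetric])
  have p_nonneg: "p x y \<ge> 0" for x y
    unfolding p_def using H_pos[of y] by (auto simp: h_def)
  have p_sum: "(\<Sum>x\<in>X. p x y) = 1" for y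
    unfolding p_def sum_divide_distrib[symmetric] using H_pos[of y] by (simp add: H_def)
  \<comment> \<open>The index \<open>k\<close> enters only through the bounded coefficients
    \<open>f k x\<close>; the functions to be integrated are the finitely many \<open>p x\<close>.
    This makes the convergence uniform in \<open>k\<close>.\<close>
  define f' where "f' k y = (\<Sum>x\<in>X. f k x * p x y)" for k y
  have close: "\<bar>f k y - f' k y\<bar> \<le> e / 4" for k y
  proof -
    have "f k y - f' k y = (\<Sum>x\<in>X. (f k y - f k x) * p x y)"
      using p_sum[of y] by (simp add: f'_def left_diff_distrib sum_subtractf sum_distrib_left[symmetric])
    also have "\<bar>\<dots>\<bar> \<le> (\<Sum>x\<in>X. (e / 4) * p x y)"
    proof (rule order_trans[OF sum_abs sum_mono])
      fix x assume "x \<in> X"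
      show "\<bar>(f k y - f k x) * p x y\<bar> \<le> e / 4 * p x y"
      proof (cases "dist x y < \<delta> x")
        case True
        then have "\<bar>f k y - f k x\<bar> * p x y \<le> e / 4 * p x y"
          using \<delta>(2)[OF True, of k] p_nonneg[of x y]
          by (intro mult_right_mono) (auto simp: abs_minus_commute)
        then show ?thesis using p_nonneg[of x y] by (simp only: abs_mult abs_of_nonneg)
      qed (simp add: p_def h_def)
    qed
    also have "\<dots> = e / 4" unfolding sum_distrib_left[symmetric] p_sum by simp
    finally show ?thesis .
  qed
  have f_cont: "continuous_on UNIV (f k)" for k
    unfolding continuous_on_iff
  proof (intro ballI allI impI)
    fix z and e :: real assume "e > 0"
    from equi[OF this, of z] obtain d where "d > 0" "\<And>y k. dist z y < d \<Longrightarrow> \<bar>f k z - f k y\<bar> < e" by blast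
    then show "\<exists>d>0. \<forall>y\<in>UNIV. dist y z < d \<longrightarrow> dist (f k y) (f k z) < e"
      by (auto simp: dist_commute[of _ z] dist_real_def abs_minus_commute intro!: exI[of _ d])
  qed
  have f'_cont: "continuous_on UNIV (f' k)" for k
    unfolding f'_def by (intro continuous_intros p_cont)
  have approx: "\<bar>integral\<^sup>L \<kappa> (f k) - (\<Sum>x\<in>X. f k x * integral\<^sup>L \<kappa> (p x))\<bar> \<le> e / 4"
    if \<kappa>: "prob_space \<kappa>" "sets \<kappa> = sets borel" for \<kappa> k
  proof -
    interpret prob_space \<kappa> by fact
    note int = integrable_continuous_compact_UNIV[OF comp _ \<kappa>]
    have "integral\<^sup>L \<kappa> (f' k) = (\<Sum>x\<in>X. f k x * integral\<^sup>L \<kappa> (p x))"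
      unfolding f'_def using int[OF p_cont] by simp
    moreover have "\<bar>\<integral>y. f k y - f' k y \<partial>\<kappa>\<bar> \<le> (\<integral>y. e / 4 \<partial>\<kappa>)"
      using close int[OF f_cont[of k]] int[OF f'_cont[of k]]
      by (intro integral_abs_bound[THEN order_trans] integral_mono) auto
    ultimately show ?thesis
      using int[OF f_cont[of k]] int[OF f'_cont[of k]] by (simp add: prob_space)
  qed
  have "0 \<le> B" using bdd[of undefined undefined] by linarith
  \<comment> \<open>An error below \<open>\<eta>\<close> in each integral of \<open>p x\<close>
    costs at most \<open>B * card X * \<eta>\<close>, hence at most \<open>e / 4\<close>; the added
    1 keeps \<open>t\<close> positive. Approximating \<open>f k\<close> by \<open>f' k\<close> under
    both measures costs another \<open>e / 4\<close> each.\<close>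
  define t where "t = B * card X + 1"
  have "t > 0" using \<open>0 \<le> B\<close> by (simp add: t_def add_nonneg_pos)
  define \<eta> where "\<eta> = e / (4 * t)"
  have \<eta>: "\<eta> > 0" "t * \<eta> = e / 4"
    using \<open>e > 0\<close> \<open>t > 0\<close> by (simp_all add: \<eta>_def)
  have "\<forall>\<^sub>F n in sequentially. \<forall>x\<in>X. \<bar>integral\<^sup>L (\<mu> n) (p x) - integral\<^sup>L \<nu> (p x)\<bar> < \<eta>"
    using tendstoD[OF conv[OF p_cont] \<eta>(1)] X(1)
    by (intro eventually_ball_finite) (auto simp: dist_real_def)
  then show ?thesis
  proof eventually_elim
    case (elim n)
    show ?case
    proof
      fix k
      have "\<bar>(\<Sum>x\<in>X. f k x * integral\<^sup>L (\<mu> n) (p x)) - (\<Sum>x\<in>X. f k x * integral\<^sup>L \<nu> (p x))\<bar>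
          = \<bar>\<Sum>x\<in>X. f k x * (integral\<^sup>L (\<mu> n) (p x) - integral\<^sup>L \<nu> (p x))\<bar>"
        by (simp add: right_diff_distrib sum_subtractf)
      also have "\<dots> \<le> (\<Sum>x\<in>X. B * \<eta>)"
        using bdd elim \<open>0 \<le> B\<close>
        by (intro order_trans[OF sum_abs sum_mono]) (auto simp: abs_mult less_imp_le intro!: mult_mono)
      also have "\<dots> \<le> e / 4" using \<eta> by (simp add: t_def algebra_simps)
      finally show "\<bar>integral\<^sup>L (\<mu> n) (f k) - integral\<^sup>L \<nu> (f k)\<bar> < e"
        using approx[OF \<mu>, of n k] approx[OF \<nu>, of k] \<open>e > 0\<close> by linarith
    qed
  qed
qed

subsection \<open>Independent random maps\<close>

text \<open>The defining recursion appends the last map; conditioning on the first map of a path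
  requires splitting at the other end.\<close>

lemma seq_comp_Suc_left: "seq_comp \<gamma> (Suc k) = seq_comp (\<lambda>i. \<gamma> (Suc i)) k \<circ> \<gamma> 0"
  by (induction k) (auto simp: fun_eq_iff)

text \<open>\<open>seq_comp \<gamma> k\<close> already uses \<open>k + 1\<close> maps, so the
  remaining path starts at index \<open>Suc k\<close>.\<close>

lemma seq_comp_add: "seq_comp \<gamma> (Suc k + m) = seq_comp (\<lambda>i. \<gamma> (Suc k + i)) m \<circ> seq_comp \<gamma> k"
  by (induction m) (auto simp: fun_eq_iff)

lemma seq_comp_in_comp_semigroup:
  assumes "\<And>i. \<gamma> i \<in> \<Gamma>"
  shows "seq_comp \<gamma> k \<in> comp_semigroup \<Gamma>"
  using assms by (induction k) (auto intro: comp_semigroup.intros)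

text \<open>The probabilistic part is carried out for continuous self-maps of a compact Polish
  space; \<open>S\<close> is specialised to \<open>NHM\<close> at the end.\<close>

locale random_maps = prob_space \<tau>
  for \<tau> :: "('a::polish_space \<Rightarrow> 'a) measure" +
  fixes S :: "('a \<Rightarrow> 'a) set"
  assumes compact_UNIV: "compact (UNIV :: 'a set)"
    and continuous_S: "\<And>g. g \<in> S \<Longrightarrow> continuous_on UNIV g"
    and sets_tau: "sets \<tau> = sets (borel_of (subtopology compact_open S))"
begin

abbreviation "X \<equiv> subtopology compact_open S"

lemma topspace_X: "topspace X = S"
  unfolding topspace_subtopology topspace_compact_open using continuous_S by blast

lemma space_tau: "space \<tau> = S"
  using sets_eq_imp_space_eq[OF sets_tau] unfolding borel_of_def space_measure_of_conv topspace_X .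

lemma openin_sets_tau: "openin X N \<Longrightarrow> N \<in> sets \<tau>"
  unfolding sets_tau borel_of_def
  using openin_subset[of X] by (subst sets_measure_of) (auto simp: topspace_X)

lemma openin_maps_into: "compact K \<Longrightarrow> open U \<Longrightarrow> openin X {g \<in> S. g ` K \<subseteq> U}"
proof -
  assume "compact K" "open U"
  then have "openin compact_open {f. continuous_on UNIV f \<and> f ` K \<subseteq> U}"
    unfolding compact_open_def by (intro topology_generated_by_Basis) blast
  moreover have "{g \<in> S. g ` K \<subseteq> U} = {f. continuous_on UNIV f \<and> f ` K \<subseteq> U} \<inter> S"
    using continuous_S by auto
  ultimately show ?thesis unfolding openin_subtopology by blast
qed

lemma compact_closure: "compact (closure (B :: 'a set))"
  using closed_Int_compact[OF closed_closure compact_UNIV] by simp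

text \<open>Passing to closures matters because they are compact: the condition on
  \<open>closure B\<close> is then open in the compact-open topology, while \<open>B\<close> still
  ranges over a countable base.\<close>

lemma basis_closure_maps_into:
  assumes \<B>: "topological_basis \<B>" and g: "continuous_on UNIV g" and U: "open U" "g z \<in> U"
  obtains B where "B \<in> \<B>" "(z :: 'a) \<in> B" "g ` closure B \<subseteq> (U :: 'a set)"
proof -
  have "open (g -` U)" using g U(1) by (simp add: continuous_on_open_vimage)
  then obtain e where e: "e > 0" "cball z e \<subseteq> g -` U"
    using U(2) open_contains_cball by (metis vimage_eq)
  obtain B where B: "B \<in> \<B>" "z \<in> B" "B \<subseteq> ball z e"
    using topological_basisE[OF \<B>, of "ball z e" z] e(1) by auto
  have "closure B \<subseteq> cball z e"
    using B(3) by (intro closure_minimal) auto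
  with B e(2) show thesis by (intro that) auto
qed

text \<open>By \<open>basis_closure_maps_into\<close> the preimage of an open set is a countable
  union of measurable rectangles, hence lies in the product sigma-algebra.\<close>

lemma measurable_eval: "(\<lambda>(g, z). g z) \<in> borel_measurable (\<tau> \<Otimes>\<^sub>M borel)"
proof (rule borel_measurableI)
  fix U :: "'a set" assume U: "open U"
  obtain \<B> :: "'a set set" where \<B>: "countable \<B>" "topological_basis \<B>"
    using ex_countable_basis by blast
  have "(\<lambda>(g, z). g z) -` U \<inter> space (\<tau> \<Otimes>\<^sub>M borel) = (\<Union>B\<in>\<B>. {g \<in> S. g ` closure B \<subseteq> U} \<times> B)"
    (is "?L = ?R")
  proof (intro equalityI subsetI)
    fix x assume "x \<in> ?L"
    then obtain g z where x: "x = (g, z)" "g \<in> S" "g z \<in> U"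
      by (auto simp: space_pair_measure space_tau)
    obtain B where "B \<in> \<B>" "z \<in> B" "g ` closure B \<subseteq> U"
      using basis_closure_maps_into[OF \<B>(2) continuous_S[OF x(2)] U x(3)] by blast
    with x show "x \<in> ?R" by auto
  next
    fix x assume "x \<in> ?R"
    then obtain B g z where x: "x = (g, z)" "g \<in> S" "g ` closure B \<subseteq> U" "z \<in> B" by blast
    then have "g z \<in> U" using closure_subset[of B] by blast
    with x show "x \<in> ?L" by (simp add: space_pair_measure space_tau)
  qed
  also have "\<dots> \<in> sets (\<tau> \<Otimes>\<^sub>M borel)"
    using \<B>(1)
  proof (rule sets.countable_UN')
    show "(\<lambda>B. {g \<in> S. g ` closure B \<subseteq> U} \<times> B) ` \<B> \<subseteq> sets (\<tau> \<Otimes>\<^sub>M borel)"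
      using topological_basis_open[OF \<B>(2)] openin_sets_tau[OF openin_maps_into[OF compact_closure U]]
      by auto
  qed
  finally show "(\<lambda>(g, z). g z) -` U \<inter> space (\<tau> \<Otimes>\<^sub>M borel) \<in> sets (\<tau> \<Otimes>\<^sub>M borel)" .
qed

lemma measurable_app [measurable (raw)]:
  assumes "f \<in> measurable M \<tau>" "h \<in> borel_measurable M"
  shows "(\<lambda>x. f x (h x)) \<in> borel_measurable M"
proof -
  have "(\<lambda>x. (f x, h x)) \<in> M \<rightarrow>\<^sub>M \<tau> \<Otimes>\<^sub>M borel" using assms by simp
  from measurable_compose[OF this measurable_eval] show ?thesis by simp
qed

text \<open>The sets of maps sending the closure of a basic open set into a basic open set generate the
  compact-open topology, so this topology is second countable and the support of \<open>\<tau>\<close> has full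
  measure.\<close>

lemma AE_topological_support: "AE g in \<tau>. g \<in> topological_support X \<tau>"
proof -
  obtain \<B> :: "'a set set" where \<B>: "countable \<B>" "topological_basis \<B>"
    using ex_countable_basis by blast
  define \<G> where "\<G> = (\<lambda>(B, C). {g \<in> S. g ` closure B \<subseteq> C}) ` (\<B> \<times> \<B>)"
  define \<N> where "\<N> = (\<lambda>F. S \<inter> \<Inter>F) ` {F. finite F \<and> F \<subseteq> \<G>}"
  have "countable \<G>" unfolding \<G>_def using \<B>(1) by auto
  then have "countable \<N>"
    unfolding \<N>_def by (intro countable_image countable_Collect_finite_subset)
  have open_\<G>: "openin X N" if "N \<in> \<G>" for N
    using that \<B>(2) by (auto simp: \<G>_def topological_basis_open intro!: openin_maps_into compact_closure)
  have open_\<N>: "openin X N" if N: "N \<in> \<N>" for N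
  proof -
    obtain F where F: "F \<subseteq> \<G>" "finite F" "N = S \<inter> \<Inter>F" using N by (auto simp: \<N>_def)
    \<comment> \<open>Inserting \<open>S\<close> keeps the family nonempty, which covers the case
      that \<open>F\<close> is empty.\<close>
    have "openin X (\<Inter>(insert S F))"
      using F open_\<G> openin_topspace[of X] topspace_X by (intro openin_Inter) auto
    then show ?thesis by (simp add: F(3))
  qed
  have nbhd: "\<exists>F. finite F \<and> F \<subseteq> \<G> \<and> g \<in> \<Inter>F \<and> S \<inter> \<Inter>F \<subseteq> W"
    if W: "openin compact_open W" "g \<in> W" "g \<in> S" for g W
  proof -
    have "generate_topology_on {{f. continuous_on UNIV f \<and> f ` K \<subseteq> U} | K U. compact K \<and> open U} W"
      using W(1) by (simp add: compact_open_def openin_topology_generated_by_iff)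
    then show ?thesis using W(2)
    proof induction
      case (Int a b)
      then obtain F F' where F: "finite F" "F \<subseteq> \<G>" "g \<in> \<Inter>F" "S \<inter> \<Inter>F \<subseteq> a"
        and F': "finite F'" "F' \<subseteq> \<G>" "g \<in> \<Inter>F'" "S \<inter> \<Inter>F' \<subseteq> b" by auto
      have "S \<inter> \<Inter>(F \<union> F') \<subseteq> a \<inter> b"
        unfolding Inter_Un_distrib using F(4) F'(4) by blast
      with F F' show ?case by (intro exI[of _ "F \<union> F'"]) (simp add: Inter_Un_distrib)
    next
      case (UN K)
      then obtain V where V: "V \<in> K" "g \<in> V" by blast
      with UN obtain F where "finite F \<and> F \<subseteq> \<G> \<and> g \<in> \<Inter>F \<and> S \<inter> \<Inter>F \<subseteq> V" by meson
      with V(1) show ?case by (intro exI[of _ F]) auto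
    next
      case (Basis V)
      then obtain K U where KU: "V = {f. continuous_on UNIV f \<and> f ` K \<subseteq> U}" "compact K" "open U"
        by blast
      \<comment> \<open>Finitely many such \<open>B\<close> cover \<open>K\<close>, and the
        corresponding finitely many conditions from \<open>\<G>\<close> force a map to send
        \<open>K\<close> into \<open>U\<close>.\<close>
      have "\<exists>B C. B \<in> \<B> \<and> C \<in> \<B> \<and> z \<in> B \<and> g ` closure B \<subseteq> C \<and> C \<subseteq> U" if "z \<in> K" for z
      proof -
        have "g z \<in> U" using that Basis(2) KU(1) by blast
        then obtain C where C: "C \<in> \<B>" "g z \<in> C" "C \<subseteq> U"
          using topological_basisE[OF \<B>(2) KU(3)] by blast
        obtain B where "B \<in> \<B>" "z \<in> B" "g ` closure B \<subseteq> C"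
          using basis_closure_maps_into[OF \<B>(2) continuous_S[OF W(3)] topological_basis_open[OF \<B>(2) C(1)] C(2)]
          by blast
        with C show ?thesis by blast
      qed
      then obtain b c where bc: "\<And>z. z \<in> K \<Longrightarrow>
          b z \<in> \<B> \<and> c z \<in> \<B> \<and> z \<in> b z \<and> g ` closure (b z) \<subseteq> c z \<and> c z \<subseteq> U" by metis
      obtain K' where K': "K' \<subseteq> K" "finite K'" "K \<subseteq> (\<Union>z\<in>K'. b z)"
      proof (rule compactE_image[OF KU(2), of K b])
        show "open (b z)" if "z \<in> K" for z using bc[OF that] \<B>(2) topological_basis_open by blast
        show "K \<subseteq> (\<Union>z\<in>K. b z)" using bc by blast
      qed
      define F where "F = (\<lambda>z. {g \<in> S. g ` closure (b z) \<subseteq> c z}) ` K'"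
      have "F \<subseteq> \<G>" unfolding F_def \<G>_def using K'(1) bc by auto
      moreover have "finite F" unfolding F_def using K'(2) by simp
      moreover have "g \<in> \<Inter>F" unfolding F_def using K'(1) bc W(3) by blast
      moreover have "S \<inter> \<Inter>F \<subseteq> V"
      proof
        fix f assume f: "f \<in> S \<inter> \<Inter>F"
        have "f x \<in> U" if "x \<in> K" for x
        proof -
          have "x \<in> (\<Union>z\<in>K'. b z)" using K'(3) that by blast
          then obtain z where z: "z \<in> K'" "x \<in> b z" by auto
          then have "f x \<in> c z" using f closure_subset[of "b z"] unfolding F_def by blast
          then show ?thesis using z(1) K'(1) bc by blast
        qed
        then show "f \<in> V" using f continuous_S by (auto simp: KU(1))
      qed
      ultimately show ?case by blast
    qed simp
  qed
  \<comment> \<open>For a map in \<open>S\<close> outside this countable union, every member of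
    \<open>\<N>\<close> containing it has positive measure, and so does every neighbourhood, since
    it contains such a member.\<close>
  have "(\<Union>N\<in>{N \<in> \<N>. emeasure \<tau> N = 0}. N) \<in> null_sets \<tau>"
    using \<open>countable \<N>\<close> open_\<N> openin_sets_tau by (intro null_sets_UN') (auto simp: null_sets_def)
  then have "AE g in \<tau>. g \<notin> (\<Union>N\<in>{N \<in> \<N>. emeasure \<tau> N = 0}. N)" by (rule AE_not_in)
  moreover have "AE g in \<tau>. g \<in> S" unfolding space_tau[symmetric] by (rule AE_space)
  ultimately show ?thesis
  proof eventually_elim
    case (elim g)
    have "emeasure \<tau> N > 0" if N: "openin X N" "g \<in> N" for N
    proof -
      obtain W where W: "openin compact_open W" "N = W \<inter> S"
        using N(1) unfolding openin_subtopology by blast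
      have "g \<in> W" "g \<in> S" using N(2) W(2) by auto
      from nbhd[OF W(1) this] obtain F where F: "finite F" "F \<subseteq> \<G>" "g \<in> \<Inter>F" "S \<inter> \<Inter>F \<subseteq> W"
        by blast
      then have "S \<inter> \<Inter>F \<in> \<N>" unfolding \<N>_def by blast
      moreover have "g \<in> S \<inter> \<Inter>F" using F(3) elim(2) by simp
      ultimately have "emeasure \<tau> (S \<inter> \<Inter>F) \<noteq> 0" using elim(1) by blast
      moreover have "emeasure \<tau> (S \<inter> \<Inter>F) \<le> emeasure \<tau> N"
        using F(4) W(2) N(1) openin_sets_tau by (intro emeasure_mono) auto
      ultimately show ?thesis by (metis less_le_trans zero_less_iff_neq_zero)
    qed
    then show ?case using elim(2) unfolding topological_support_def topspace_X by blast
  qed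
qed

section \<open>Paths of independent maps and the probability of staying in a closed set\<close>

definition path_measure :: "(nat \<Rightarrow> 'a \<Rightarrow> 'a) measure"
  where "path_measure = PiM UNIV (\<lambda>_. \<tau>)"

lemma prob_space_path_measure: "prob_space path_measure"
  unfolding path_measure_def by (intro prob_space_PiM prob_space_axioms)

lemma space_path_measure: "space path_measure = {\<gamma>. \<forall>i. \<gamma> i \<in> S}"
  by (auto simp: path_measure_def space_PiM space_tau PiE_def)

lemma measurable_seq_comp [measurable (raw)]:
  assumes "f \<in> measurable M path_measure" "h \<in> borel_measurable M"
  shows "(\<lambda>x. seq_comp (f x) k (h x)) \<in> borel_measurable M"
proof (induction k)
  have [measurable]: "(\<lambda>x. f x i) \<in> measurable M \<tau>" for i
    using assms(1) unfolding path_measure_def by measurable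
  {
    case 0
    show ?case using assms(2) by simp
  next
    case (Suc k)
    then show ?case by simp
  }
qed

lemma continuous_seq_comp:
  assumes "\<gamma> \<in> space path_measure"
  shows "continuous_on UNIV (seq_comp \<gamma> k)"
proof (induction k)
  case 0
  then show ?case using assms continuous_S by (simp add: space_path_measure)
next
  case (Suc k)
  have "continuous_on UNIV (\<gamma> (Suc k))" using assms continuous_S by (simp add: space_path_measure)
  then show ?case
    unfolding seq_comp.simps
    by (intro continuous_on_compose Suc.IH) (rule continuous_on_subset, auto)
qed

text \<open>The Markov property at the first step: a random path is a random first map followed by
  an independent path of the same law. Boundedness of \<open>f\<close> justifies Fubini.\<close>

lemma integral_path_measure:
  fixes f :: "(nat \<Rightarrow> 'a \<Rightarrow> 'a) \<Rightarrow> real"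
  assumes f [measurable]: "f \<in> borel_measurable path_measure" and B: "\<And>\<gamma>. \<bar>f \<gamma>\<bar> \<le> B"
  shows "(\<integral>\<gamma>. f \<gamma> \<partial>path_measure) = (\<integral>g. (\<integral>\<gamma>. f (case_nat g \<gamma>) \<partial>path_measure) \<partial>\<tau>)"
proof -
  interpret seq: sequence_space \<tau> ..
  interpret P: pair_prob_space \<tau> path_measure
    by (intro pair_prob_space.intro pair_sigma_finite.intro prob_space_path_measure prob_space_axioms
        prob_space_imp_sigma_finite)
  have m [measurable]: "(\<lambda>(g, \<gamma>). case_nat g \<gamma>) \<in> \<tau> \<Otimes>\<^sub>M path_measure \<rightarrow>\<^sub>M path_measure"
    unfolding path_measure_def by measurable
  have "(\<integral>\<gamma>. f \<gamma> \<partial>path_measure) = (\<integral>\<gamma>. f \<gamma> \<partial>(distr (\<tau> \<Otimes>\<^sub>M path_measure) path_measure (\<lambda>(g, \<gamma>). case_nat g \<gamma>)))"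
    using seq.PiM_iter by (simp add: path_measure_def)
  also have "\<dots> = (\<integral>x. f (case x of (g, \<gamma>) \<Rightarrow> case_nat g \<gamma>) \<partial>(\<tau> \<Otimes>\<^sub>M path_measure))"
    by (rule integral_distr[OF m f])
  also have "\<dots> = (\<integral>g. (\<integral>\<gamma>. f (case_nat g \<gamma>) \<partial>path_measure) \<partial>\<tau>)"
    using B by (subst P.integral_fst'[symmetric]) (auto intro!: P.integrable_const_bound[of _ B])
  finally show ?thesis .
qed

text \<open>The starting point is not tested, since \<open>seq_comp \<gamma> 0 z\<close> is already
  \<open>\<gamma> 0 z\<close>. This is why the indicator in \<open>avoid_prob_rec\<close> is
  evaluated at \<open>g z\<close>, and it matches a semigroup generated without adjoining the
  identity.\<close>

definition avoid_prob :: "'a set \<Rightarrow> 'a \<Rightarrow> real"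
  where "avoid_prob A z = measure path_measure {\<gamma> \<in> space path_measure. \<forall>k. seq_comp \<gamma> k z \<in> A}"

lemma avoid_sets [measurable]:
  assumes "closed A"
  shows "{\<gamma> \<in> space path_measure. \<forall>k. seq_comp \<gamma> k z \<in> A} \<in> sets path_measure"
proof -
  have [measurable]: "A \<in> sets borel" using assms by simp
  show ?thesis by measurable
qed

lemma avoid_prob_bounds: "0 \<le> avoid_prob A z" "avoid_prob A z \<le> 1"
  using prob_space.prob_le_1[OF prob_space_path_measure] by (auto simp: avoid_prob_def)

lemma avoid_prob_rec:
  assumes "closed A"
  shows "avoid_prob A z = (\<integral>g. indicator A (g z) * avoid_prob A (g z) \<partial>\<tau>)"
proof -
  interpret P: prob_space path_measure by (rule prob_space_path_measure)
  define E where "E z = {\<gamma> \<in> space path_measure. \<forall>k. seq_comp \<gamma> k z \<in> A}" for z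
  have E: "E z \<in> sets path_measure" for z unfolding E_def using assms by (rule avoid_sets)
  have avoid: "avoid_prob A z = (\<integral>\<gamma>. indicator (E z) \<gamma> \<partial>path_measure)" for z
    using E by (simp add: avoid_prob_def E_def[symmetric] Int_absorb1 sets.sets_into_space)
  have "avoid_prob A z = (\<integral>g. (\<integral>\<gamma>. indicator (E z) (case_nat g \<gamma>) \<partial>path_measure) \<partial>\<tau>)"
    unfolding avoid using E by (intro integral_path_measure[of _ 1]) (auto simp: indicator_def)
  also have "\<dots> = (\<integral>g. indicator A (g z) * avoid_prob A (g z) \<partial>\<tau>)"
  proof (rule Bochner_Integration.integral_cong[OF refl])
    fix g assume "g \<in> space \<tau>"
    have all_nat_iff: "(\<forall>k. seq_comp (case_nat g \<gamma>) k z \<in> A) \<longleftrightarrow> seq_comp (case_nat g \<gamma>) 0 z \<in> A \<and>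
        (\<forall>k. seq_comp (case_nat g \<gamma>) (Suc k) z \<in> A)" for \<gamma>
      by (metis not0_implies_Suc)
    have "case_nat g \<gamma> \<in> E z \<longleftrightarrow> g z \<in> A \<and> \<gamma> \<in> E (g z)" if "\<gamma> \<in> space path_measure" for \<gamma>
    proof -
      have "(\<forall>k. seq_comp (case_nat g \<gamma>) k z \<in> A) \<longleftrightarrow> g z \<in> A \<and> (\<forall>k. seq_comp \<gamma> k (g z) \<in> A)"
        unfolding all_nat_iff by (simp only: seq_comp_Suc_left seq_comp.simps(1) o_apply nat.case)
      then show ?thesis
        using that \<open>g \<in> space \<tau>\<close> by (auto simp: E_def space_path_measure space_tau split: nat.split)
    qed
    then have "(\<integral>\<gamma>. indicator (E z) (case_nat g \<gamma>) \<partial>path_measure) =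
        (\<integral>\<gamma>. (indicator A (g z) * indicator (E (g z)) \<gamma> :: real) \<partial>path_measure)"
      by (intro Bochner_Integration.integral_cong) (auto simp: indicator_def)
    then show "(\<integral>\<gamma>. indicator (E z) (case_nat g \<gamma>) \<partial>path_measure) = indicator A (g z) * avoid_prob A (g z)"
      by (simp add: avoid)
  qed
  finally show ?thesis .
qed

text \<open>A path that keeps infinitely many \<open>y n\<close> in \<open>A\<close> at all times
  also keeps their limit there, because its compositions are continuous and \<open>A\<close> is
  closed. So the limit superior of the events for \<open>y n\<close> lies in the event for
  \<open>z\<close>, and measures of the decreasing sets \<open>D n\<close> pass to the
  limit.\<close>

lemma avoid_prob_upper_semicontinuous:
  assumes A: "closed A" and y: "y \<longlonglongrightarrow> z" and le: "\<And>n. a \<le> avoid_prob A (y n)"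
  shows "a \<le> avoid_prob A z"
proof -
  interpret P: prob_space path_measure by (rule prob_space_path_measure)
  define E where "E z = {\<gamma> \<in> space path_measure. \<forall>k. seq_comp \<gamma> k z \<in> A}" for z
  have E [measurable]: "E z \<in> sets path_measure" for z unfolding E_def using A by (rule avoid_sets)
  define D where "D n = (\<Union>m\<in>{n..}. E (y m))" for n
  have D: "D n \<in> sets path_measure" for n unfolding D_def by auto
  have "decseq D" unfolding D_def decseq_def by fastforce
  have lim: "(\<lambda>n. P.prob (D n)) \<longlonglongrightarrow> P.prob (\<Inter>n. D n)"
    by (rule P.finite_Lim_measure_decseq[OF _ \<open>decseq D\<close>]) (use D in auto)
  have "a \<le> P.prob (D n)" for n
  proof -
    have "a \<le> P.prob (E (y n))" using le[of n] by (simp add: avoid_prob_def E_def)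
    also have "\<dots> \<le> P.prob (D n)" by (rule P.finite_measure_mono) (use D in \<open>auto simp: D_def\<close>)
    finally show ?thesis .
  qed
  then have "a \<le> P.prob (\<Inter>n. D n)" by (intro tendsto_lowerbound[OF lim]) auto
  also have "\<dots> \<le> P.prob (E z)"
  proof (rule P.finite_measure_mono)
    show "(\<Inter>n. D n) \<subseteq> E z"
    proof
      fix \<gamma> assume \<gamma>: "\<gamma> \<in> (\<Inter>n. D n)"
      then have sp: "\<gamma> \<in> space path_measure" by (auto simp: D_def E_def)
      have "seq_comp \<gamma> k z \<in> A" for k
      proof (rule ccontr)
        assume "seq_comp \<gamma> k z \<notin> A"
        moreover have "(\<lambda>n. seq_comp \<gamma> k (y n)) \<longlonglongrightarrow> seq_comp \<gamma> k z"
          using continuous_on_tendsto_compose[OF continuous_seq_comp[OF sp] y] by simp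
        ultimately have "\<forall>\<^sub>F n in sequentially. seq_comp \<gamma> k (y n) \<in> - A"
          using A by (intro topological_tendstoD[where l = "seq_comp \<gamma> k z"]) auto
        then obtain N where N: "\<And>n. n \<ge> N \<Longrightarrow> seq_comp \<gamma> k (y n) \<notin> A"
          by (auto simp: eventually_sequentially)
        have "\<gamma> \<in> D N" using \<gamma> by blast
        then show False using N by (auto simp: D_def E_def)
      qed
      with sp show "\<gamma> \<in> E z" by (simp add: E_def)
    qed
  qed simp
  finally show ?thesis by (simp add: avoid_prob_def E_def)
qed

text \<open>Maximum principle: the points where \<open>avoid_prob A\<close> attains a positive maximum are mapped into
  \<open>A\<close>, and again to such points, by every map in the support of \<open>\<tau>\<close>.\<close>

lemma avoid_prob_eq_0:
  assumes A: "closed A"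
    and escape: "\<And>z. \<exists>h\<in>comp_semigroup (topological_support X \<tau>). h z \<notin> A"
  shows "avoid_prob A z = 0"
proof -
  define c where "c = (SUP z. avoid_prob A z)"
  have bdd: "bdd_above (range (avoid_prob A))" using avoid_prob_bounds by (intro bdd_aboveI[of _ 1]) auto
  have le_c: "avoid_prob A z \<le> c" for z unfolding c_def by (rule cSUP_upper[OF _ bdd]) simp
  have "\<exists>y. c - inverse (Suc n) < avoid_prob A y" for n
    using less_cSUP_iff[OF _ bdd, of "c - inverse (Suc n)"] by (auto simp: c_def[symmetric])
  then obtain y where y: "\<And>n. c - inverse (Suc n) < avoid_prob A (y n)" by metis
  obtain z0 r where r: "strict_mono (r :: nat \<Rightarrow> nat)" "(y \<circ> r) \<longlonglongrightarrow> z0"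
    using compact_UNIV unfolding compact_def by (metis UNIV_I)
  \<comment> \<open>From index \<open>n\<close> on the subsequence keeps this lower bound, because
    \<open>r (m + n)\<close> is at least \<open>n\<close>.\<close>
  have "c - inverse (Suc n) \<le> avoid_prob A z0" for n
  proof (rule avoid_prob_upper_semicontinuous[OF A])
    show "(\<lambda>m. (y \<circ> r) (m + n)) \<longlonglongrightarrow> z0" using r(2) by (rule LIMSEQ_ignore_initial_segment)
    show "c - inverse (Suc n) \<le> avoid_prob A ((y \<circ> r) (m + n))" for m
    proof -
      have "inverse (Suc (r (m + n))) \<le> inverse (Suc n)"
        using seq_suble[OF r(1), of "m + n"] by (simp add: le_imp_inverse_le)
      then show ?thesis using y[of "r (m + n)"] unfolding o_apply by linarith
    qed
  qed
  then have "c \<le> avoid_prob A z0"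
    using LIMSEQ_le_const2[OF tendsto_diff[OF tendsto_const LIMSEQ_inverse_real_of_nat, of c]] by auto
  then have z0: "avoid_prob A z0 = c" using le_c[of z0] by simp
  show ?thesis
  proof (cases "c > 0")
    case False
    then show ?thesis using le_c[of z] avoid_prob_bounds(1)[of A z] by simp
  next
    case True
    define Q where "Q = {z \<in> A. c \<le> avoid_prob A z}"
    have "closed Q"
      unfolding closed_sequential_limits
    proof (intro allI impI)
      fix x l assume x: "(\<forall>n. x n \<in> Q) \<and> x \<longlonglongrightarrow> l"
      then have "l \<in> A" using A unfolding closed_sequential_limits Q_def by blast
      moreover have "c \<le> avoid_prob A l"
        by (rule avoid_prob_upper_semicontinuous[OF A, of x]) (use x in \<open>auto simp: Q_def\<close>)
      ultimately show "l \<in> Q" by (simp add: Q_def)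
    qed
    have step: "g w \<in> Q" if w: "avoid_prob A w = c" and g: "g \<in> topological_support X \<tau>" for g w
    proof (rule ccontr)
      assume "g w \<notin> Q"
      \<comment> \<open>Closedness of \<open>Q\<close> makes this a neighbourhood of
        \<open>g\<close>, so a map in the support forces it to have positive measure.\<close>
      define N where "N = {g \<in> S. g ` {w} \<subseteq> - Q}"
      have N: "openin X N" unfolding N_def using \<open>closed Q\<close> by (intro openin_maps_into) auto
      have "g \<in> N" using g \<open>g w \<notin> Q\<close> by (auto simp: N_def topological_support_def topspace_X)
      then have pos: "emeasure \<tau> N > 0" using g N by (auto simp: topological_support_def)
      define f where "f g = indicator A (g w) * avoid_prob A (g w)" for g :: "'a \<Rightarrow> 'a"
      have [measurable]: "A \<in> sets borel" using A by simp
      have "avoid_prob A \<in> borel_measurable borel"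
        unfolding borel_measurable_iff_ge
      proof
        fix a
        have "closed {w. a \<le> avoid_prob A w}"
          unfolding closed_sequential_limits using avoid_prob_upper_semicontinuous[OF A] by blast
        then show "{w \<in> space borel. a \<le> avoid_prob A w} \<in> sets borel" by simp
      qed
      then have f_meas [measurable]: "f \<in> borel_measurable \<tau>" unfolding f_def by measurable
      have f_le: "f g \<le> c" "\<bar>f g\<bar> \<le> 1" for g
        using le_c[of "g w"] avoid_prob_bounds[of A "g w"] True by (auto simp: f_def indicator_def)
      have f_int: "integrable \<tau> f" by (rule integrable_const_bound[of _ 1]) (auto simp: f_le)
      \<comment> \<open>The integrand is nonnegative and averages to 0 at a maximum point, so
        \<open>f\<close> equals \<open>c\<close> almost surely. As \<open>c\<close> is positive,
        \<open>g w\<close> then lies in \<open>A\<close> and is again a maximum point.\<close>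
      have "(\<integral>g. c - f g \<partial>\<tau>) = 0"
        using f_int w avoid_prob_rec[OF A, of w] by (simp add: prob_space f_def[symmetric])
      then have "AE g in \<tau>. c - f g = 0"
        by (subst (asm) integral_nonneg_eq_0_iff_AE) (use f_int f_le in auto)
      then have "AE g in \<tau>. g \<notin> N"
      proof eventually_elim
        case (elim g)
        then have "g w \<in> Q" using True by (cases "g w \<in> A") (auto simp: f_def Q_def)
        then show ?case by (simp add: N_def)
      qed
      then have "emeasure \<tau> N = 0"
        using openin_sets_tau[OF N] by (subst (asm) AE_iff_null_sets[symmetric]) auto
      with pos show False by simp
    qed
    have "h w \<in> Q" if "h \<in> comp_semigroup (topological_support X \<tau>)" "avoid_prob A w = c" for h w
      using that
    proof (induction arbitrary: w)
      case (gen g)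
      then show ?case using step by blast
    next
      case (comp g h)
      then have "avoid_prob A (h w) = c" using le_c[of "h w"] by (force simp: Q_def)
      then show ?case using comp.IH(1) by simp
    qed
    then show ?thesis using escape[of z0] z0 by (auto simp: Q_def)
  qed
qed

lemma AE_hit:
  assumes A: "closed A"
    and escape: "\<And>z. \<exists>h\<in>comp_semigroup (topological_support X \<tau>). h z \<notin> A"
  shows "AE \<gamma> in path_measure. \<exists>k. seq_comp \<gamma> k z \<notin> A"
proof -
  interpret P: prob_space path_measure by (rule prob_space_path_measure)
  have "{\<gamma> \<in> space path_measure. \<forall>k. seq_comp \<gamma> k z \<in> A} \<in> null_sets path_measure"
    using avoid_prob_eq_0[OF assms, of z] avoid_sets[OF A, of z]
    by (auto simp: avoid_prob_def P.emeasure_eq_measure null_sets_def)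
  then show ?thesis
    by (rule AE_I') auto
qed

lemma AE_path_support: "AE \<gamma> in path_measure. \<forall>i. \<gamma> i \<in> topological_support X \<tau>"
  unfolding path_measure_def AE_all_countable
  by (intro allI AE_PiM_component AE_topological_support prob_space_axioms) auto

section \<open>The dual operator and the iterates of the transition operator\<close>

definition push :: "'a measure \<Rightarrow> 'a measure"
  where "push \<mu> = distr (\<tau> \<Otimes>\<^sub>M \<mu>) borel (\<lambda>(g, z). g z)"

lemma measurable_eval':
  assumes "sets \<mu> = sets borel"
  shows "(\<lambda>(g, z). g z) \<in> borel_measurable (\<tau> \<Otimes>\<^sub>M \<mu>)"
  using measurable_eval sets_pair_measure_cong[OF refl assms, of \<tau>] by (simp cong: measurable_cong_sets)

lemma pair_prob_space_tau: "prob_space \<mu> \<Longrightarrow> pair_prob_space \<tau> \<mu>"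
  by (intro pair_prob_space.intro pair_sigma_finite.intro prob_space_axioms prob_space_imp_sigma_finite)

lemma push_in_prob_measures:
  assumes "\<mu> \<in> prob_measures euclidean"
  shows "push \<mu> \<in> prob_measures euclidean"
proof -
  have \<mu>: "prob_space \<mu>" "sets \<mu> = sets borel"
    using assms by (auto simp: prob_measures_iff borel_of_euclidean)
  interpret P: pair_prob_space \<tau> \<mu> by (rule pair_prob_space_tau[OF \<mu>(1)])
  show ?thesis
    using P.prob_space_distr[OF measurable_eval'[OF \<mu>(2)]]
    by (simp add: prob_measures_iff borel_of_euclidean push_def)
qed

lemma integral_push:
  fixes \<phi> :: "'a \<Rightarrow> real"
  assumes \<mu>: "\<mu> \<in> prob_measures euclidean"
    and \<phi>: "\<phi> \<in> borel_measurable borel" "\<And>z. \<bar>\<phi> z\<bar> \<le> B"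
  shows "integral\<^sup>L (push \<mu>) \<phi> = (\<integral>z. (\<integral>g. \<phi> (g z) \<partial>\<tau>) \<partial>\<mu>)"
proof -
  have \<mu>: "prob_space \<mu>" "sets \<mu> = sets borel"
    using assms(1) by (auto simp: prob_measures_iff borel_of_euclidean)
  interpret P: pair_prob_space \<tau> \<mu> by (rule pair_prob_space_tau[OF \<mu>(1)])
  note ev = measurable_eval'[OF \<mu>(2)]
  have meas: "(\<lambda>(g, z). \<phi> (g z)) \<in> borel_measurable (\<tau> \<Otimes>\<^sub>M \<mu>)"
    using measurable_compose[OF ev \<phi>(1)] by (simp add: case_prod_beta)
  have "integral\<^sup>L (push \<mu>) \<phi> = (\<integral>x. (case x of (g, z) \<Rightarrow> \<phi> (g z)) \<partial>(\<tau> \<Otimes>\<^sub>M \<mu>))"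
    unfolding push_def
    by (subst integral_distr[OF ev \<phi>(1)]) (rule Bochner_Integration.integral_cong, auto)
  also have "\<dots> = (\<integral>z. (\<integral>g. \<phi> (g z) \<partial>\<tau>) \<partial>\<mu>)"
    using meas \<phi>(2) by (intro P.integral_snd[symmetric] P.integrable_const_bound[of _ B]) auto
  finally show ?thesis .
qed

text \<open>For bounded Borel functions this is the \<open>(k + 1)\<close>-st power of the
  transition operator. Writing all powers as expectations over one path space lets a single almost
  sure statement about paths control every \<open>k\<close>.\<close>

definition path_mean :: "nat \<Rightarrow> ('a \<Rightarrow> real) \<Rightarrow> 'a \<Rightarrow> real"
  where "path_mean k \<phi> z = (\<integral>\<gamma>. \<phi> (seq_comp \<gamma> k z) \<partial>path_measure)"

lemma measurable_path_mean:
  assumes [measurable]: "\<phi> \<in> borel_measurable borel"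
  shows "path_mean k \<phi> \<in> borel_measurable borel"
proof -
  interpret P: prob_space path_measure by (rule prob_space_path_measure)
  show ?thesis unfolding path_mean_def by measurable
qed

lemma path_mean_bounded:
  assumes [measurable]: "\<phi> \<in> borel_measurable borel" and B: "\<And>z. \<bar>\<phi> z\<bar> \<le> B"
  shows "\<bar>path_mean k \<phi> z\<bar> \<le> B"
proof -
  interpret P: prob_space path_measure by (rule prob_space_path_measure)
  have "\<bar>path_mean k \<phi> z\<bar> \<le> (\<integral>\<gamma>. \<bar>\<phi> (seq_comp \<gamma> k z)\<bar> \<partial>path_measure)"
    unfolding path_mean_def by (rule integral_abs_bound)
  also have "\<dots> \<le> (\<integral>\<gamma>. B \<partial>path_measure)"
  proof -
    have "0 \<le> B" using B[of undefined] by linarith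
    then show ?thesis
      using B by (intro integral_mono P.integrable_const_bound[of _ B]) auto
  qed
  finally show ?thesis by (simp add: P.prob_space)
qed

lemma path_mean_0:
  assumes [measurable]: "\<phi> \<in> borel_measurable borel" and B: "\<And>z. \<bar>\<phi> z\<bar> \<le> B"
  shows "path_mean 0 \<phi> z = (\<integral>g. \<phi> (g z) \<partial>\<tau>)"
proof -
  interpret P: prob_space path_measure by (rule prob_space_path_measure)
  have "(\<lambda>\<gamma>. \<phi> (seq_comp \<gamma> 0 z)) \<in> borel_measurable path_measure" by measurable
  from integral_path_measure[OF this B] show ?thesis
    by (simp add: path_mean_def P.prob_space)
qed

lemma path_mean_Suc:
  assumes [measurable]: "\<phi> \<in> borel_measurable borel" and B: "\<And>z. \<bar>\<phi> z\<bar> \<le> B"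
  shows "path_mean (Suc k) \<phi> z = (\<integral>g. path_mean k \<phi> (g z) \<partial>\<tau>)"
proof -
  have "path_mean (Suc k) \<phi> z =
      (\<integral>g. (\<integral>\<gamma>. \<phi> (seq_comp (case_nat g \<gamma>) (Suc k) z) \<partial>path_measure) \<partial>\<tau>)"
    unfolding path_mean_def by (rule integral_path_measure[OF _ B]) measurable
  also have "\<dots> = (\<integral>g. path_mean k \<phi> (g z) \<partial>\<tau>)"
    unfolding seq_comp_Suc_left path_mean_def by simp
  finally show ?thesis .
qed

lemma push_funpow_in_prob_measures:
  "\<mu> \<in> prob_measures euclidean \<Longrightarrow> (push ^^ k) \<mu> \<in> prob_measures euclidean"
  by (induction k) (auto intro: push_in_prob_measures)

text \<open>The innermost \<open>push\<close> corresponds to the first map of the path, so the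
  induction peels it off and lets \<open>\<mu>\<close> vary.\<close>

lemma integral_push_funpow:
  fixes \<phi> :: "'a \<Rightarrow> real"
  assumes \<mu>: "\<mu> \<in> prob_measures euclidean"
    and \<phi>: "\<phi> \<in> borel_measurable borel" "\<And>z. \<bar>\<phi> z\<bar> \<le> B"
  shows "integral\<^sup>L ((push ^^ Suc k) \<mu>) \<phi> = integral\<^sup>L \<mu> (path_mean k \<phi>)"
  using \<mu>
proof (induction k arbitrary: \<mu>)
  case 0
  then show ?case using integral_push[OF 0 \<phi>] path_mean_0[OF \<phi>] by (simp cong: Bochner_Integration.integral_cong)
next
  case (Suc k)
  have "integral\<^sup>L ((push ^^ Suc (Suc k)) \<mu>) \<phi> = integral\<^sup>L ((push ^^ Suc k) (push \<mu>)) \<phi>"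
    by (simp add: funpow_swap1)
  also have "\<dots> = integral\<^sup>L (push \<mu>) (path_mean k \<phi>)"
    by (rule Suc.IH[OF push_in_prob_measures[OF Suc.prems]])
  also have "\<dots> = integral\<^sup>L \<mu> (path_mean (Suc k) \<phi>)"
    using integral_push[OF Suc.prems measurable_path_mean[OF \<phi>(1)] path_mean_bounded[OF \<phi>]]
      path_mean_Suc[OF \<phi>] by (simp cong: Bochner_Integration.integral_cong)
  finally show ?case .
qed

text \<open>The definite description is justified here: Fubini gives \<open>push \<mu>\<close> the
  prescribed integrals, and integrals of continuous functions determine the measure.\<close>

lemma transition_dual_eq_push:
  assumes \<mu>: "\<mu> \<in> prob_measures euclidean"
  shows "transition_dual \<tau> \<mu> = push \<mu>"
proof -
  have eq: "integral\<^sup>L (push \<mu>) \<phi> = integral\<^sup>L \<mu> (transition \<tau> \<phi>)"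
    if \<phi>: "continuous_on UNIV \<phi>" for \<phi> :: "'a \<Rightarrow> real"
  proof -
    obtain B where "\<And>x. \<bar>\<phi> x\<bar> \<le> B"
      using continuous_imp_bounded_compact_UNIV[OF compact_UNIV \<phi>] by blast
    from integral_push[OF \<mu> borel_measurable_continuous_onI[OF \<phi>] this]
    show ?thesis unfolding transition_def .
  qed
  show ?thesis
    unfolding transition_dual_def
  proof (rule the_equality)
    show "push \<mu> \<in> prob_measures euclidean \<and>
        (\<forall>\<phi>. continuous_on UNIV \<phi> \<longrightarrow> integral\<^sup>L (push \<mu>) \<phi> = integral\<^sup>L \<mu> (transition \<tau> \<phi>))"
      using push_in_prob_measures[OF \<mu>] eq by blast
    fix \<nu> assume \<nu>: "\<nu> \<in> prob_measures euclidean \<and>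
        (\<forall>\<phi>. continuous_on UNIV \<phi> \<longrightarrow> integral\<^sup>L \<nu> \<phi> = integral\<^sup>L \<mu> (transition \<tau> \<phi>))"
    show "\<nu> = push \<mu>"
      by (rule measure_eqI_integral_continuous)
        (use \<nu> eq push_in_prob_measures[OF \<mu>] in \<open>auto simp: prob_measures_iff borel_of_euclidean\<close>)
  qed
qed

lemma transition_dual_funpow:
  assumes "\<mu> \<in> prob_measures euclidean"
  shows "(transition_dual \<tau> ^^ k) \<mu> = (push ^^ k) \<mu>"
  by (induction k) (simp_all add: transition_dual_eq_push push_funpow_in_prob_measures assms)

text \<open>The radius in the hypothesis varies with the path. If the claim failed, there would be
  points \<open>y n\<close> tending to \<open>z\<close> and times \<open>k n\<close> with
  differences of at least \<open>e\<close>; along almost every path the differences tend to 0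
  whatever the times, and dominated convergence gives a contradiction.\<close>

lemma path_mean_equicontinuous:
  assumes \<phi>: "continuous_on UNIV \<phi>"
    and ae: "AE \<gamma> in path_measure. \<forall>e>0. \<exists>\<delta>>0. \<forall>y k. dist z y < \<delta> \<longrightarrow>
      \<bar>\<phi> (seq_comp \<gamma> k z) - \<phi> (seq_comp \<gamma> k y)\<bar> < e"
    and "e > 0"
  shows "\<exists>\<delta>>0. \<forall>y k. dist z y < \<delta> \<longrightarrow> \<bar>path_mean k \<phi> z - path_mean k \<phi> y\<bar> < e"
proof (rule ccontr)
  interpret P: prob_space path_measure by (rule prob_space_path_measure)
  have [measurable]: "\<phi> \<in> borel_measurable borel" by (rule borel_measurable_continuous_onI[OF \<phi>])
  obtain B where B: "\<And>x. \<bar>\<phi> x\<bar> \<le> B"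
    using continuous_imp_bounded_compact_UNIV[OF compact_UNIV \<phi>] by blast
  assume *: "\<not> ?thesis"
  have "\<exists>y k. dist z y < inverse (Suc n) \<and> e \<le> \<bar>path_mean k \<phi> z - path_mean k \<phi> y\<bar>" for n
  proof -
    have "inverse (real (Suc n)) > 0" by simp
    with * show ?thesis by (meson not_less)
  qed
  then obtain y k where y: "\<And>n. dist z (y n) < inverse (Suc n)"
    and far: "\<And>n. e \<le> \<bar>path_mean (k n) \<phi> z - path_mean (k n) \<phi> (y n)\<bar>" by metis
  define h where "h n \<gamma> = \<phi> (seq_comp \<gamma> (k n) z) - \<phi> (seq_comp \<gamma> (k n) (y n))" for n \<gamma>
  have int: "integrable path_measure (\<lambda>\<gamma>. \<phi> (seq_comp \<gamma> k y))" for k y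
    by (rule P.integrable_const_bound[of _ B]) (use B in auto)
  have h: "(\<integral>\<gamma>. h n \<gamma> \<partial>path_measure) = path_mean (k n) \<phi> z - path_mean (k n) \<phi> (y n)" for n
    unfolding h_def path_mean_def by (rule Bochner_Integration.integral_diff) (rule int)+
  have "(\<lambda>n. \<integral>\<gamma>. h n \<gamma> \<partial>path_measure) \<longlonglongrightarrow> (\<integral>\<gamma>. 0 \<partial>path_measure)"
  proof (rule integral_dominated_convergence[where w = "\<lambda>_. B + B"])
    show "h n \<in> borel_measurable path_measure" for n
      unfolding h_def by measurable
    show "AE \<gamma> in path_measure. norm (h n \<gamma>) \<le> B + B" for n
    proof (rule AE_I2)
      show "norm (h n \<gamma>) \<le> B + B" for \<gamma>
        using B[of "seq_comp \<gamma> (k n) z"] B[of "seq_comp \<gamma> (k n) (y n)"]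
        unfolding h_def real_norm_def by linarith
    qed
    show "AE \<gamma> in path_measure. (\<lambda>n. h n \<gamma>) \<longlonglongrightarrow> 0"
      using ae
    proof eventually_elim
      case (elim \<gamma>)
      show ?case
      proof (rule tendstoI)
        fix r :: real assume "r > 0"
        then obtain \<delta> where \<delta>: "\<delta> > 0"
          "\<And>y k. dist z y < \<delta> \<Longrightarrow> \<bar>\<phi> (seq_comp \<gamma> k z) - \<phi> (seq_comp \<gamma> k y)\<bar> < r"
          using elim by blast
        have "\<forall>\<^sub>F n in sequentially. inverse (Suc n) < \<delta>"
          using order_tendstoD(2)[OF LIMSEQ_inverse_real_of_nat \<delta>(1)] .
        then show "\<forall>\<^sub>F n in sequentially. dist (h n \<gamma>) 0 < r"
        proof eventually_elim
          case (elim n)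
          then have "dist z (y n) < \<delta>" using y[of n] by linarith
          then show ?case using \<delta>(2) by (simp add: h_def)
        qed
      qed
    qed
  qed auto
  then have "(\<lambda>n. path_mean (k n) \<phi> z - path_mean (k n) \<phi> (y n)) \<longlonglongrightarrow> 0"
    by (simp add: h)
  then have "\<forall>\<^sub>F n in sequentially. \<bar>path_mean (k n) \<phi> z - path_mean (k n) \<phi> (y n)\<bar> < e"
    using tendstoD[OF _ \<open>e > 0\<close>] by (fastforce simp: dist_real_def)
  then show False using far by (auto simp: eventually_sequentially not_less[symmetric])
qed

text \<open>Weak limits of two sequences of images agree on every continuous function, hence coincide;
  compactness of the space of probability measures turns this into closeness for any metric \<open>\<rho>\<close>.\<close>

lemma F_meas_eq_prob_measures:
  assumes equi: "\<And>(\<phi> :: 'a \<Rightarrow> real) z e. continuous_on UNIV \<phi> \<Longrightarrow> e > 0 \<Longrightarrow>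
      \<exists>\<delta>>0. \<forall>y k. dist z y < \<delta> \<longrightarrow> \<bar>path_mean k \<phi> z - path_mean k \<phi> y\<bar> < e"
    and \<rho>: "mtopology_of \<rho> = weak_topology (euclidean :: 'a topology)"
  shows "F_meas \<rho> \<tau> = prob_measures euclidean"
proof -
  have space_\<rho>: "mspace \<rho> = prob_measures (euclidean :: 'a topology)"
    using topspace_weak_topology[of "euclidean :: 'a topology"] \<rho> topspace_mtopology_of[of \<rho>] by simp
  interpret R: Metric_space "mspace \<rho>" "mdist \<rho>" by (rule Metric_space_mspace_mdist)
  have R_top: "R.mtopology = weak_topology (euclidean :: 'a topology)"
    using \<rho> by (simp add: mtopology_of_def)
  have "equicontinuous \<rho> \<rho> (mspace \<rho>) ((\<lambda>k. transition_dual \<tau> ^^ k) ` {1..})"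
    unfolding equicontinuous_def
  proof (intro ballI allI impI, rule ccontr)
    fix \<mu> and e :: real
    assume \<mu>: "\<mu> \<in> mspace \<rho>" and "e > 0"
      and *: "\<not> (\<exists>\<delta>>0. \<forall>\<nu>\<in>mspace \<rho>. mdist \<rho> \<mu> \<nu> < \<delta> \<longrightarrow>
        (\<forall>f\<in>(\<lambda>k. transition_dual \<tau> ^^ k) ` {1..}. mdist \<rho> (f \<mu>) (f \<nu>) < e))"
    note \<mu>' = \<mu>[unfolded space_\<rho>]
    have "\<exists>\<nu> k. \<nu> \<in> mspace \<rho> \<and> mdist \<rho> \<mu> \<nu> < inverse (Suc n) \<and>
        e \<le> mdist \<rho> ((push ^^ Suc k) \<mu>) ((push ^^ Suc k) \<nu>)" for n
    proof -
      have "inverse (real (Suc n)) > 0" by simp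
      then obtain \<nu> f where \<nu>: "\<nu> \<in> mspace \<rho>" "mdist \<rho> \<mu> \<nu> < inverse (Suc n)"
        and f: "f \<in> (\<lambda>k. transition_dual \<tau> ^^ k) ` {1..}" "\<not> mdist \<rho> (f \<mu>) (f \<nu>) < e"
        using * by meson
      \<comment> \<open>Exponents start at 1; writing them as \<open>Suc k\<close> matches
        \<open>integral_push_funpow\<close>.\<close>
      from f(1) obtain k where k: "f = transition_dual \<tau> ^^ Suc k"
        by (auto dest: Suc_le_D)
      have "f \<mu> = (push ^^ Suc k) \<mu>" "f \<nu> = (push ^^ Suc k) \<nu>"
        unfolding k using \<mu>' \<nu>(1) by (simp_all only: transition_dual_funpow space_\<rho>)
      with \<nu> f(2) show ?thesis by (metis not_less)
    qed
    then obtain \<nu> k where \<nu>: "\<And>n. \<nu> n \<in> mspace \<rho>" "\<And>n. mdist \<rho> \<mu> (\<nu> n) < inverse (Suc n)"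
      and far: "\<And>n. e \<le> mdist \<rho> ((push ^^ Suc (k n)) \<mu>) ((push ^^ Suc (k n)) (\<nu> n))" by metis
    note \<nu>' = \<nu>(1)[unfolded space_\<rho>]
    define \<alpha> where "\<alpha> n = (push ^^ Suc (k n)) \<mu>" for n
    define \<beta> where "\<beta> n = (push ^^ Suc (k n)) (\<nu> n)" for n
    have \<alpha>: "\<alpha> n \<in> prob_measures euclidean" and \<beta>: "\<beta> n \<in> prob_measures euclidean" for n
      unfolding \<alpha>_def \<beta>_def using \<mu>' \<nu>' by (blast intro: push_funpow_in_prob_measures)+
    have pm: "prob_space \<kappa>" "sets \<kappa> = sets borel" if "\<kappa> \<in> prob_measures euclidean" for \<kappa> :: "'a measure"
      using that by (auto simp: prob_measures_iff borel_of_euclidean)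
    have cm: "continuous_map euclidean euclideanreal \<phi>" "bounded (\<phi> ` topspace euclidean)"
      if "continuous_on UNIV \<phi>" for \<phi> :: "'a \<Rightarrow> real"
      using that compact_imp_bounded[OF compact_continuous_image[OF that compact_UNIV]] by auto
    have lim_\<nu>: "limitin (weak_topology euclidean) \<nu> \<mu> sequentially"
    proof -
      have "(\<lambda>n. mdist \<rho> (\<nu> n) \<mu>) \<longlonglongrightarrow> 0"
        by (rule tendsto_sandwich[OF _ _ tendsto_const LIMSEQ_inverse_real_of_nat])
          (use \<nu>(2) in \<open>auto simp: R.commute less_imp_le\<close>)
      then show ?thesis
        unfolding R_top[symmetric] R.limitin_metric_dist_null using \<mu> \<nu>(1) by simp
    qed
    \<comment> \<open>The exponent \<open>k n\<close> changes with \<open>n\<close>, so weak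
      convergence of \<open>\<nu> n\<close> must be uniform over all test functions
      \<open>path_mean k \<phi>\<close>; their equicontinuity provides this.\<close>
    have diff: "(\<lambda>n. integral\<^sup>L (\<beta> n) \<phi> - integral\<^sup>L (\<alpha> n) \<phi>) \<longlonglongrightarrow> 0"
      if \<phi>: "continuous_on UNIV \<phi>" for \<phi> :: "'a \<Rightarrow> real"
    proof (rule tendstoI)
      fix r :: real assume "r > 0"
      obtain B where B: "\<And>x. \<bar>\<phi> x\<bar> \<le> B"
        using continuous_imp_bounded_compact_UNIV[OF compact_UNIV \<phi>] by blast
      note \<phi>_meas = borel_measurable_continuous_onI[OF \<phi>]
      have "\<forall>\<^sub>F n in sequentially. \<forall>k. \<bar>integral\<^sup>L (\<nu> n) (path_mean k \<phi>) - integral\<^sup>L \<mu> (path_mean k \<phi>)\<bar> < r"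
        by (rule weak_convergence_uniform_on_equicontinuous[OF compact_UNIV, of _ _ _ B])
          (use pm \<mu>' \<nu>' limitin_weak_topologyD[OF lim_\<nu>] cm path_mean_bounded[OF \<phi>_meas B] equi[OF \<phi>] \<open>r > 0\<close>
            in \<open>auto\<close>)
      then show "\<forall>\<^sub>F n in sequentially. dist (integral\<^sup>L (\<beta> n) \<phi> - integral\<^sup>L (\<alpha> n) \<phi>) 0 < r"
        unfolding \<alpha>_def \<beta>_def integral_push_funpow[OF \<mu>' \<phi>_meas B] integral_push_funpow[OF \<nu>' \<phi>_meas B]
        by eventually_elim simp
    qed
    \<comment> \<open>Compactness is applied to \<open>\<alpha>\<close> alone; \<open>diff\<close>
      gives \<open>\<beta>\<close> the same limit along the same subsequence.\<close>
    obtain r \<alpha>' where r: "strict_mono r" and \<alpha>': "prob_space \<alpha>'" "sets \<alpha>' = sets borel"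
      and lim_\<alpha>: "\<And>\<phi> :: 'a \<Rightarrow> real. continuous_on UNIV \<phi> \<Longrightarrow>
        (\<lambda>n. integral\<^sup>L (\<alpha> (r n)) \<phi>) \<longlonglongrightarrow> integral\<^sup>L \<alpha>' \<phi>"
      by (rule prob_measures_weakly_sequentially_compact[OF compact_UNIV pm(1)[OF \<alpha>] pm(2)[OF \<alpha>]])
        (rule that, assumption+)
    have \<alpha>'_in: "\<alpha>' \<in> prob_measures euclidean"
      using \<alpha>' by (simp add: prob_measures_iff borel_of_euclidean)
    have lim_\<beta>: "(\<lambda>n. integral\<^sup>L (\<beta> (r n)) \<phi>) \<longlonglongrightarrow> integral\<^sup>L \<alpha>' \<phi>"
      if \<phi>: "continuous_on UNIV \<phi>" for \<phi> :: "'a \<Rightarrow> real"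
      using tendsto_add[OF LIMSEQ_subseq_LIMSEQ[OF diff[OF \<phi>] r] lim_\<alpha>[OF \<phi>]] by (simp add: o_def)
    have "limitin R.mtopology (\<lambda>n. \<alpha> (r n)) \<alpha>' sequentially" "limitin R.mtopology (\<lambda>n. \<beta> (r n)) \<alpha>' sequentially"
      unfolding R_top using \<alpha> \<beta> \<alpha>'_in lim_\<alpha> lim_\<beta> by (auto intro!: limitin_weak_topologyI)
    then have "(\<lambda>n. mdist \<rho> (\<alpha> (r n)) \<alpha>' + mdist \<rho> (\<beta> (r n)) \<alpha>') \<longlonglongrightarrow> 0 + 0"
      unfolding R.limitin_metric_dist_null by (intro tendsto_add) auto
    then have "\<forall>\<^sub>F n in sequentially. mdist \<rho> (\<alpha> (r n)) \<alpha>' + mdist \<rho> (\<beta> (r n)) \<alpha>' < e"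
      using \<open>e > 0\<close> by (intro order_tendstoD) auto
    then obtain n where "mdist \<rho> (\<alpha> (r n)) \<alpha>' + mdist \<rho> (\<beta> (r n)) \<alpha>' < e"
      using eventually_happens'[OF sequentially_bot] by blast
    moreover have "mdist \<rho> (\<alpha> (r n)) (\<beta> (r n)) \<le> mdist \<rho> (\<alpha> (r n)) \<alpha>' + mdist \<rho> (\<beta> (r n)) \<alpha>'"
      using R.triangle'[of "\<alpha> (r n)" \<alpha>' "\<beta> (r n)"] \<alpha> \<beta> \<alpha>'_in by (simp add: space_\<rho> R.commute)
    ultimately show False using far[of "r n"] by (simp add: \<alpha>_def \<beta>_def)
  qed
  moreover have "openin (mtopology_of \<rho>) (mspace \<rho>)"
    using openin_topspace[of "mtopology_of \<rho>"] by simp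
  ultimately show ?thesis unfolding F_meas_def fatou_def space_\<rho> by auto
qed

text \<open>The exchange of quantifiers by Fubini, in coordinates: \<open>h\<close> will be a chart
  inverse.\<close>

lemma AE_path_AE_lborel:
  fixes h :: "'b::euclidean_space \<Rightarrow> 'a"
  assumes A: "closed A" and [measurable]: "h \<in> borel_measurable borel"
    and hit: "\<And>z. AE \<gamma> in path_measure. \<exists>k. seq_comp \<gamma> k z \<notin> A"
  shows "AE \<gamma> in path_measure. AE w in lborel. \<exists>k. seq_comp \<gamma> k (h w) \<notin> A"
proof -
  interpret pair_sigma_finite path_measure "lborel :: 'b measure"
    by (intro pair_sigma_finite.intro sigma_finite_lborel prob_space_imp_sigma_finite prob_space_path_measure)
  have [measurable]: "A \<in> sets borel" using A by simp
  have "(AE \<gamma> in path_measure. AE w in lborel. \<exists>k. seq_comp \<gamma> k (h w) \<notin> A) \<longleftrightarrow>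
      (AE w in lborel. AE \<gamma> in path_measure. \<exists>k. seq_comp \<gamma> k (h w) \<notin> A)"
    by (rule AE_commute) measurable
  then show ?thesis using hit by simp
qed

end

subsection \<open>Fatou sets\<close>

text \<open>The neighbourhood \<open>V\<close> need not lie in \<open>U\<close>, because it can be
  cut down to the open set \<open>U\<close>. This frees the source from its metric, so
  neighbourhoods can be pulled back along continuous maps.\<close>

lemma equicontinuous_iff_open:
  assumes d: "mtopology_of d = euclidean" and U: "open U"
  shows "equicontinuous d m U \<F> \<longleftrightarrow>
    (\<forall>x\<in>U. \<forall>\<epsilon>>0. \<exists>V. open V \<and> x \<in> V \<and> (\<forall>y\<in>V. \<forall>f\<in>\<F>. mdist m (f x) (f y) < \<epsilon>))"
proof -
  interpret D: Metric_space "mspace d" "mdist d" by (rule Metric_space_mspace_mdist)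
  have D_top: "D.mtopology = euclidean" using d by (simp add: mtopology_of_def)
  have mem: "x \<in> mspace d" for x using D.topspace_mtopology D_top by simp
  have open_ball: "open (D.mball x \<delta>)" for x \<delta> using D.openin_mball[of x \<delta>] by (simp add: D_top)
  show ?thesis
    unfolding equicontinuous_def
  proof (intro ball_cong refl all_cong imp_cong)
    fix x and \<epsilon> :: real assume x: "x \<in> U"
    show "(\<exists>\<delta>>0. \<forall>y\<in>U. mdist d x y < \<delta> \<longrightarrow> (\<forall>f\<in>\<F>. mdist m (f x) (f y) < \<epsilon>)) \<longleftrightarrow>
      (\<exists>V. open V \<and> x \<in> V \<and> (\<forall>y\<in>V. \<forall>f\<in>\<F>. mdist m (f x) (f y) < \<epsilon>))"
    proof
      assume "\<exists>\<delta>>0. \<forall>y\<in>U. mdist d x y < \<delta> \<longrightarrow> (\<forall>f\<in>\<F>. mdist m (f x) (f y) < \<epsilon>)"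
      then obtain \<delta> where \<delta>: "\<delta> > 0" "\<And>y f. y \<in> U \<Longrightarrow> mdist d x y < \<delta> \<Longrightarrow> f \<in> \<F> \<Longrightarrow> mdist m (f x) (f y) < \<epsilon>"
        by blast
      have "open (U \<inter> D.mball x \<delta>)" using U open_ball by blast
      moreover have "x \<in> U \<inter> D.mball x \<delta>" using x \<delta>(1) by (simp add: mem)
      ultimately show "\<exists>V. open V \<and> x \<in> V \<and> (\<forall>y\<in>V. \<forall>f\<in>\<F>. mdist m (f x) (f y) < \<epsilon>)"
        using \<delta>(2) by (intro exI[of _ "U \<inter> D.mball x \<delta>"]) auto
    next
      assume "\<exists>V. open V \<and> x \<in> V \<and> (\<forall>y\<in>V. \<forall>f\<in>\<F>. mdist m (f x) (f y) < \<epsilon>)"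
      then obtain V where V: "open V" "x \<in> V" "\<And>y f. y \<in> V \<Longrightarrow> f \<in> \<F> \<Longrightarrow> mdist m (f x) (f y) < \<epsilon>"
        by blast
      have "openin D.mtopology V" using V(1) by (simp add: D_top)
      then obtain \<delta> where "\<delta> > 0" "D.mball x \<delta> \<subseteq> V" using V(2) by (auto simp: D.openin_mtopology)
      then show "\<exists>\<delta>>0. \<forall>y\<in>U. mdist d x y < \<delta> \<longrightarrow> (\<forall>f\<in>\<F>. mdist m (f x) (f y) < \<epsilon>)"
        using V(3) by (intro exI[of _ \<delta>]) (auto simp: mem subset_eq)
    qed
  qed
qed

lemma fatou_iff:
  assumes d: "mtopology_of d = euclidean"
  shows "z \<in> fatou d \<F> \<longleftrightarrow> (\<exists>U. open U \<and> z \<in> U \<and>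
    (\<forall>x\<in>U. \<forall>\<epsilon>>0. \<exists>V. open V \<and> x \<in> V \<and> (\<forall>y\<in>V. \<forall>f\<in>\<F>. mdist d (f x) (f y) < \<epsilon>)))"
proof -
  have "mspace d = UNIV" using d topspace_mtopology_of[of d] by simp
  then show ?thesis
    unfolding fatou_def d by (simp add: equicontinuous_iff_open[OF d] cong: conj_cong)
qed

lemma closed_julia:
  assumes "mtopology_of d = euclidean"
  shows "closed (julia d \<F>)"
proof -
  have "mspace d = UNIV" using assms topspace_mtopology_of[of d] by simp
  moreover have "open (fatou d \<F>)"
    unfolding open_subopen[of "fatou d \<F>"]
  proof
    fix z assume "z \<in> fatou d \<F>"
    then obtain U where U: "open U" "z \<in> U"
      "\<forall>x\<in>U. \<forall>\<epsilon>>0. \<exists>V. open V \<and> x \<in> V \<and> (\<forall>y\<in>V. \<forall>f\<in>\<F>. mdist d (f x) (f y) < \<epsilon>)"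
      unfolding fatou_iff[OF assms] by blast
    have "U \<subseteq> fatou d \<F>"
    proof
      fix x assume "x \<in> U"
      with U show "x \<in> fatou d \<F>" unfolding fatou_iff[OF assms] by blast
    qed
    with U show "\<exists>T. open T \<and> z \<in> T \<and> T \<subseteq> fatou d \<F>" by blast
  qed
  ultimately show ?thesis by (simp add: julia_def closed_def)
qed

text \<open>After time \<open>k\<close> the compositions are elements of the semigroup applied to
  \<open>seq_comp \<gamma> k\<close>, and equicontinuity pulls back along this continuous map. The
  finitely many compositions up to time \<open>k\<close> are handled by their continuity.\<close>

lemma fatou_range_seq_compI:
  assumes d: "mtopology_of d = euclidean"
    and cont: "\<And>k. continuous_on UNIV (seq_comp \<gamma> k)"
    and \<Gamma>: "\<And>i. \<gamma> i \<in> \<Gamma>"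
    and z: "seq_comp \<gamma> k z \<in> fatou d (comp_semigroup \<Gamma>)"
  shows "z \<in> fatou d (range (seq_comp \<gamma>))"
proof -
  interpret D: Metric_space "mspace d" "mdist d" by (rule Metric_space_mspace_mdist)
  have D_top: "D.mtopology = euclidean" using d by (simp add: mtopology_of_def)
  have mem: "x \<in> mspace d" for x using D.topspace_mtopology D_top by simp
  have open_ball: "open (D.mball x \<delta>)" for x \<delta> using D.openin_mball[of x \<delta>] by (simp add: D_top)
  have open_vimage_seq: "open (seq_comp \<gamma> i -` W)" if "open W" for i W
    using cont that by (simp add: continuous_on_open_vimage)
  obtain U where U: "open U" "seq_comp \<gamma> k z \<in> U"
    "\<And>x \<epsilon>. x \<in> U \<Longrightarrow> \<epsilon> > 0 \<Longrightarrow>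
      \<exists>V. open V \<and> x \<in> V \<and> (\<forall>y\<in>V. \<forall>f\<in>comp_semigroup \<Gamma>. mdist d (f x) (f y) < \<epsilon>)"
    using z unfolding fatou_iff[OF d] by blast
  show ?thesis
    unfolding fatou_iff[OF d]
  proof (rule exI[of _ "seq_comp \<gamma> k -` U"], intro conjI ballI allI impI)
    fix x and \<epsilon> :: real assume "x \<in> seq_comp \<gamma> k -` U" "\<epsilon> > 0"
    then obtain V where V: "open V" "seq_comp \<gamma> k x \<in> V"
      "\<And>y f. y \<in> V \<Longrightarrow> f \<in> comp_semigroup \<Gamma> \<Longrightarrow> mdist d (f (seq_comp \<gamma> k x)) (f y) < \<epsilon>"
      using U(3)[of "seq_comp \<gamma> k x" \<epsilon>] by auto
    define W where "W = seq_comp \<gamma> k -` V \<inter> (\<Inter>i\<in>{..k}. seq_comp \<gamma> i -` D.mball (seq_comp \<gamma> i x) \<epsilon>)"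
    have "open W"
      unfolding W_def by (intro open_Int open_INT open_vimage_seq V(1) open_ball ballI finite_atMost)
    moreover have "x \<in> W" using V(2) \<open>\<epsilon> > 0\<close> by (simp add: W_def mem)
    moreover have "mdist d (seq_comp \<gamma> j x) (seq_comp \<gamma> j y) < \<epsilon>" if "y \<in> W" for j y
    proof (cases "j \<le> k")
      case True
      then show ?thesis using that by (auto simp: W_def)
    next
      case False
      then obtain m where m: "j = Suc k + m" using less_iff_Suc_add[of k j] by auto
      have "seq_comp (\<lambda>i. \<gamma> (Suc k + i)) m \<in> comp_semigroup \<Gamma>"
        by (rule seq_comp_in_comp_semigroup) (rule \<Gamma>)
      from V(3)[OF _ this, of "seq_comp \<gamma> k y"] that show ?thesis
        unfolding m seq_comp_add by (simp add: W_def)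
    qed
    ultimately show "\<exists>V. open V \<and> x \<in> V \<and> (\<forall>y\<in>V. \<forall>f\<in>range (seq_comp \<gamma>). mdist d (f x) (f y) < \<epsilon>)"
      by (intro exI[of _ W]) auto
  qed (use U open_vimage_seq in auto)
qed

text \<open>Equicontinuity is measured by \<open>d\<close> in the target. By compactness
  \<open>\<phi>\<close> is uniformly continuous for \<open>d\<close>; on the source side an open
  neighbourhood translates back into a ball for \<open>dist\<close>.\<close>

lemma fatou_continuous_function:
  fixes \<phi> :: "'a::metric_space \<Rightarrow> real"
  assumes comp: "compact (UNIV :: 'a set)" and d: "mtopology_of d = euclidean"
    and \<phi>: "continuous_on UNIV \<phi>" and z: "z \<in> fatou d \<F>" and "e > 0"
  shows "\<exists>\<delta>>0. \<forall>y. \<forall>f\<in>\<F>. dist z y < \<delta> \<longrightarrow> \<bar>\<phi> (f z) - \<phi> (f y)\<bar> < e"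
proof -
  have mem: "x \<in> mspace d" for x using d topspace_mtopology_of[of d] by simp
  have "uniformly_continuous_map d euclidean_metric \<phi>"
    using \<phi> comp continuous_eq_uniformly_continuous_map[of d euclidean_metric \<phi>]
    by (simp add: d compact_space_def)
  then have "\<exists>\<eta>>0. \<forall>x\<in>mspace d. \<forall>y\<in>mspace d. mdist d y x < \<eta> \<longrightarrow>
      mdist euclidean_metric (\<phi> y) (\<phi> x) < e"
    using \<open>e > 0\<close> unfolding uniformly_continuous_map_def by blast
  then obtain \<eta> where \<eta>: "\<eta> > 0" "\<And>x y. mdist d y x < \<eta> \<Longrightarrow> \<bar>\<phi> y - \<phi> x\<bar> < e"
    using mem by (metis dist_real_def mdist_euclidean_metric)
  obtain V where V: "open V" "z \<in> V" "\<And>y f. y \<in> V \<Longrightarrow> f \<in> \<F> \<Longrightarrow> mdist d (f z) (f y) < \<eta>"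
  proof -
    obtain U where "z \<in> U"
      and U: "\<forall>x\<in>U. \<forall>\<epsilon>>0. \<exists>V. open V \<and> x \<in> V \<and> (\<forall>y\<in>V. \<forall>f\<in>\<F>. mdist d (f x) (f y) < \<epsilon>)"
      using z unfolding fatou_iff[OF d] by auto
    from U[rule_format, OF \<open>z \<in> U\<close> \<eta>(1)] show thesis using that by auto
  qed
  obtain \<delta> where "\<delta> > 0" "ball z \<delta> \<subseteq> V" using V(1,2) openE by blast
  then show ?thesis using V(3) \<eta>(2) by (intro exI[of _ \<delta>]) (auto simp: subset_eq)
qed

section \<open>Random paths when the kernel Julia set is empty\<close>

context random_maps
begin

lemma AE_path_leaves_julia:
  assumes d: "mtopology_of d = euclidean"
    and ker: "kernel_julia d (comp_semigroup (topological_support X \<tau>)) = {}"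
  shows "AE \<gamma> in path_measure. \<exists>k. seq_comp \<gamma> k z \<notin> julia d (comp_semigroup (topological_support X \<tau>))"
proof (rule AE_hit[OF closed_julia[OF d]])
  show "\<exists>h\<in>comp_semigroup (topological_support X \<tau>). h z \<notin> julia d (comp_semigroup (topological_support X \<tau>))" for z
    using ker by (auto simp: kernel_julia_def)
qed

text \<open>One null set of paths serves all \<open>z\<close> and \<open>k\<close>: it only has to
  exclude paths with some map outside the support. Hence the statement can be used after Fubini has
  exchanged points and paths.\<close>

lemma AE_julia_seq:
  assumes d: "mtopology_of d = euclidean"
  shows "AE \<gamma> in path_measure. \<forall>z k. seq_comp \<gamma> k z \<notin> julia d (comp_semigroup (topological_support X \<tau>)) \<longrightarrow>
    z \<notin> julia_seq d \<gamma>"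
  using AE_path_support AE_space
proof eventually_elim
  case (elim \<gamma>)
  have "mspace d = UNIV" using d topspace_mtopology_of[of d] by simp
  then show ?case
    using fatou_range_seq_compI[OF d continuous_seq_comp[OF elim(2)], of "topological_support X \<tau>"] elim(1)
    by (auto simp: julia_seq_def julia_def)
qed

lemma path_mean_equicontinuous_of_kernel:
  assumes d: "mtopology_of d = euclidean"
    and ker: "kernel_julia d (comp_semigroup (topological_support X \<tau>)) = {}"
    and \<phi>: "continuous_on UNIV \<phi>" and "e > 0"
  shows "\<exists>\<delta>>0. \<forall>y k. dist z y < \<delta> \<longrightarrow> \<bar>path_mean k \<phi> z - path_mean k \<phi> y\<bar> < e"
proof (rule path_mean_equicontinuous[OF \<phi> _ \<open>e > 0\<close>])
  show "AE \<gamma> in path_measure. \<forall>e>0. \<exists>\<delta>>0. \<forall>y k. dist z y < \<delta> \<longrightarrow>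
      \<bar>\<phi> (seq_comp \<gamma> k z) - \<phi> (seq_comp \<gamma> k y)\<bar> < e"
    using AE_path_leaves_julia[OF d ker, of z] AE_julia_seq[OF d]
  proof eventually_elim
    case (elim \<gamma>)
    have "mspace d = UNIV" using d topspace_mtopology_of[of d] by simp
    then have "z \<in> fatou d (range (seq_comp \<gamma>))"
      using elim by (auto simp: julia_seq_def julia_def)
    from fatou_continuous_function[OF compact_UNIV d \<phi> this] show ?case by fastforce
  qed
qed

end

theorem theorem3p14:
  fixes d :: "'n::finite cproj metric"
    and \<tau> :: "('n cproj \<Rightarrow> 'n cproj) measure"
  assumes "mtopology_of d = euclidean"
    and "\<tau> \<in> prob_measures_c NHM_top"
    and "kernel_julia d (semigroup_of \<tau>) = {}"
  shows "(\<forall>\<rho>. mtopology_of \<rho> = weak_topology euclidean \<longrightarrow>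
            F_meas \<rho> \<tau> = prob_measures euclidean) \<and>
         (AE \<gamma> in PiM UNIV (\<lambda>_::nat. \<tau>). julia_seq d \<gamma> \<in> null_sets leb_cproj)"
proof -
  note d = assms(1) and ker = assms(3)[unfolded semigroup_of_def]
  have \<tau>: "prob_space \<tau>" "sets \<tau> = sets (borel_of NHM_top)"
    using assms(2) unfolding prob_measures_c_def mem_Collect_eq prob_measures_iff by blast+
  interpret random_maps \<tau> NHM
    by (intro random_maps.intro random_maps_axioms.intro \<tau> compact_UNIV_cproj)
      (simp add: NHM_def holomorphic_cproj_def)
  define A where "A = julia d (comp_semigroup (topological_support NHM_top \<tau>))"
  \<comment> \<open>Null sets of \<open>leb_cproj\<close> are recognised chart by chart, and the
    finitely many charts share one exceptional set of paths.\<close>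
  have "AE \<gamma> in path_measure. \<forall>i. AE w in lborel. \<exists>k. seq_comp \<gamma> k (chart_inv i w) \<notin> A"
    unfolding AE_all_countable A_def
    by (intro allI AE_path_AE_lborel closed_julia d measurable_chart_inv AE_path_leaves_julia ker)
  then have "AE \<gamma> in path_measure. julia_seq d \<gamma> \<in> null_sets leb_cproj"
    using AE_julia_seq[OF d]
  proof eventually_elim
    case (elim \<gamma>)
    have closed: "closed (julia_seq d \<gamma>)" unfolding julia_seq_def by (rule closed_julia[OF d])
    have "negligible (chart_inv i -` julia_seq d \<gamma>)" for i
    proof -
      have "AE w in lborel. w \<notin> chart_inv i -` julia_seq d \<gamma>"
        using elim(1)[rule_format, of i] by eventually_elim (use elim(2) in \<open>auto simp: A_def\<close>)
      \<comment> \<open>Closedness of the Julia set supplies the measurability that turns the almost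
        everywhere statement into membership in the null sets.\<close>
      moreover have "chart_inv i -` julia_seq d \<gamma> \<in> sets lborel"
        using measurable_sets_borel[OF measurable_chart_inv borel_closed[OF closed]] by simp
      ultimately have "chart_inv i -` julia_seq d \<gamma> \<in> null_sets lborel"
        by (simp only: AE_iff_null_sets)
      then show ?thesis
        by (simp add: negligible_iff_null_sets null_sets_completionI)
    qed
    then show ?case
      unfolding null_sets_leb_cproj_iff chart_image using closed by simp
  qed
  moreover have "F_meas \<rho> \<tau> = prob_measures euclidean" if "mtopology_of \<rho> = weak_topology euclidean" for \<rho>
    by (rule F_meas_eq_prob_measures[OF path_mean_equicontinuous_of_kernel[OF d ker] that])
  ultimately show ?thesis unfolding path_measure_def by blast
qed

end
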